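(* Let $a_1,\ldots,a_r>0$ with $a_1,\ldots,a_{r-1}$ pairwise distinct. Let $0<q_j<1$ for $1\le j\le r$ with $\sum_{j=1}^r q_j=1$, and for each positive integer $n$ let $\vec n=(n_1,\ldots,n_r)$ with $n_j=\lfloor q_jn\rfloor$ (so that $|\vec n|/n\to1$ as $n\to\infty$). For each positive integer $N$ let $C_{\vec n}$ be the multiple Charlier polynomials for the Poisson distributions with parameters $(a_1,a_2,\ldots,a_{r-1},Na_r)$, i.e. the last parameter grows linearly with $N$ (so $C_{\vec n}$ depends on $N$), and let $x_{\vec n,1}<\cdots<x_{\vec n,|\vec n|}$ be the zeros of $C_{\vec n}$. Then for every $t>0$ there exist real numbers $\alpha_t<\beta_t$ with $(1-q_r)t\le\alpha_t$ and a probability density $v$ on $[\alpha_t,\beta_t]$ such that $$\lim_{n,N\to\infty,\ n/N\to t}\frac{1}{|\vec n|}\sum_{j=1}^{|\vec n|}f(x_{\vec n,j}/N)=\frac1t\int_0^{(1-q_r)t}f(x)\,dx+q_r\int_{\alpha_t}^{\beta_t}v(x)f(x)\,dx$$ for every bounded continuous function $f$ on $[0,\infty)$.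
   Context: For pairwise distinct $b_1,\ldots,b_r>0$ and a multi-index $\vec n=(n_1,\ldots,n_r)$ of non-negative integers with size $|\vec n|=n_1+\cdots+n_r$, the multiple Charlier polynomial $C_{\vec n}$ with parameters $(b_1,\ldots,b_r)$ is the (unique) monic polynomial of degree $|\vec n|$ such that $$\sum_{k=0}^\infty C_{\vec n}(k)\,k^\ell\,\frac{b_j^k}{k!}=0,\qquad \ell=0,1,\ldots,n_j-1,\quad j=1,\ldots,r$$ (with $k^0=1$ for all $k$, including $k=0$). Its zeros are all real, simple and lie in $(0,\infty)$. In the claim $b_j=a_j$ for $j<r$ and $b_r=Na_r$; these are pairwise distinct for all sufficiently large $N$. The limit is taken as the positive integers $n,N$ both tend to infinity in such a way that $n/N\to t$. A probability density on $[\alpha_t,\beta_t]$ is a non-negative integrable function with integral $1$ over that interval. *)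

theory Defs
  imports "HOL-Analysis.Analysis" "HOL-Computational_Algebra.Polynomial"
begin

text \<open>Multi-indices and parameter vectors are functions on \<open>nat\<close> of which only the values at
  \<open>1, \<dots>, r\<close> are used.\<close>

definition mi_size :: "nat \<Rightarrow> (nat \<Rightarrow> nat) \<Rightarrow> nat" where
  "mi_size r m = (\<Sum>j=1..r. m j)"

definition is_multiple_charlier ::
    "nat \<Rightarrow> (nat \<Rightarrow> real) \<Rightarrow> (nat \<Rightarrow> nat) \<Rightarrow> real poly \<Rightarrow> bool" where
  "is_multiple_charlier r b m P \<longleftrightarrow>
     lead_coeff P = 1 \<and> degree P = mi_size r m \<and>
     (\<forall>j\<in>{1..r}. \<forall>l<m j.
        (\<lambda>k. poly P (real k) * real k ^ l * (b j ^ k / fact k)) sums 0)"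

text \<open>Meaningful when the parameters \<open>b 1, \<dots>, b r\<close> are positive and pairwise distinct, in which
  case there is exactly one such polynomial.\<close>

definition multiple_charlier ::
    "nat \<Rightarrow> (nat \<Rightarrow> real) \<Rightarrow> (nat \<Rightarrow> nat) \<Rightarrow> real poly" where
  "multiple_charlier r b m = (THE P. is_multiple_charlier r b m P)"

text \<open>The \<open>j\<close>-th smallest real zero, counted from \<open>j = 1\<close>.  For positive, pairwise distinct
  parameters there are exactly \<open>mi_size r m\<close> real zeros, all simple, so that
  \<open>j = 1, \<dots>, mi_size r m\<close> enumerates them all in increasing order.\<close>

definition charlier_zero ::
    "nat \<Rightarrow> (nat \<Rightarrow> real) \<Rightarrow> (nat \<Rightarrow> nat) \<Rightarrow> nat \<Rightarrow> real" where
  "charlier_zero r b m j =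
     sorted_list_of_set {x. poly (multiple_charlier r b m) x = 0} ! (j - 1)"

definition floor_index :: "(nat \<Rightarrow> real) \<Rightarrow> nat \<Rightarrow> nat \<Rightarrow> nat" where
  "floor_index q n j = nat \<lfloor>q j * real n\<rfloor>"

definition scaled_params :: "nat \<Rightarrow> (nat \<Rightarrow> real) \<Rightarrow> nat \<Rightarrow> nat \<Rightarrow> real" where
  "scaled_params r a N j = (if j = r then real N * a r else a j)"

definition prob_density_on :: "real \<Rightarrow> real \<Rightarrow> (real \<Rightarrow> real) \<Rightarrow> bool" where
  "prob_density_on \<alpha> \<beta> v \<longleftrightarrow>
     (\<forall>x\<in>{\<alpha>..\<beta>}. 0 \<le> v x) \<and> set_integrable lborel {\<alpha>..\<beta>} v \<and> (LBINT x:{\<alpha>..\<beta>}. v x) = 1"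

definition zero_average ::
    "nat \<Rightarrow> (nat \<Rightarrow> real) \<Rightarrow> (nat \<Rightarrow> real) \<Rightarrow> nat \<Rightarrow> nat \<Rightarrow> (real \<Rightarrow> real) \<Rightarrow> real" where
  "zero_average r a q n N f =
     (let m = floor_index q n
      in 1 / real (mi_size r m) *
         (\<Sum>j=1..mi_size r m. f (charlier_zero r (scaled_params r a N) m j / real N)))"

end

theory Submission
  imports Defs "HOL-Probability.Probability"
begin

text \<open>
  Write \<open>(S P)(x) = x P(x - 1)\<close> and \<open>L b = S - b\<close> (the constant \<open>poisson_raise b\<close>).  Summing by
  parts against the Poisson weight \<open>c^k / k!\<close> moves \<open>L b\<close> onto the test polynomial, where it becomes
  \<open>Q(x) \<mapsto> c Q(x + 1) - b Q(x)\<close>.  This keeps the degree of \<open>Q\<close> if \<open>b \<noteq> c\<close> and lowers it by one if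
  \<open>b = c\<close>.  So \<open>L b\<close> adds one orthogonality relation for the parameter \<open>b\<close> and preserves those for
  all other parameters; together with uniqueness this shows that the multiple Charlier polynomial is
  obtained from 1 by applying \<open>L (b j)\<close> exactly \<open>n j\<close> times for each \<open>j\<close>
  (\<open>multiple_charlier_eq\<close>).  These operators commute, which makes it possible to treat the parameters
  one at a time and in any order.

  If the zeros of \<open>P\<close> are nonnegative and consecutive ones differ by at least 1, then for \<open>b \<ge> 0\<close>
  the same is true of \<open>L b P\<close>, because the zeros \<open>0, x 0 + 1, x 1 + 1, \<dots>\<close> of \<open>S P\<close> interlace with the
  zeros \<open>x 0, x 1, \<dots>\<close> of \<open>P\<close> (\<open>mesh_zeros_raise\<close>).  Moreover, changing the parameter \<open>b\<close> to 0 moves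
  every zero to the left, and the sum of the zeros drops by exactly \<open>b\<close>
  (\<open>zeros_above_zero_params\<close>).  Change the \<open>p = n 1 + \<dots> + n (r - 1)\<close> bounded parameters to 0 in this
  way.  What remains is \<open>S^p\<close> applied to the ordinary Charlier polynomial of degree \<open>n r\<close> with
  parameter \<open>N a r\<close>, and its zeros are \<open>0, \<dots>, p - 1\<close> followed by the Charlier zeros shifted by \<open>p\<close>.
  The total displacement is \<open>O(n)\<close>, hence after division by \<open>N\<close> the mean displacement is \<open>O(1/N)\<close> and
  the two families of zeros have the same limit.  The naturals below \<open>p\<close> give the uniform part on
  \<open>[0, (1 - q r) t]\<close>; the shifted Charlier zeros give the rest, with \<open>\<alpha> = (1 - q r) t\<close>.

  It remains to see that the zeros of the Charlier polynomials of degree \<open>m\<close> with parameter \<open>N a\<close>,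
  divided by \<open>N\<close>, have a limit distribution with a compactly supported density when \<open>m/N\<close> tends to
  \<open>c > 0\<close> (\<open>charlier_zero_distribution\<close>).
  \<^item> For \<open>z > 0\<close> the products of \<open>z + zero/N\<close> over the zeros satisfy the three-term recurrence.  The
    ratios of consecutive products follow a contraction whose fixed point changes slowly with the
    degree, so they stay close to it; therefore the mean of \<open>ln (z + zero/N)\<close> converges, to the same
    limit for all admissible sequences (\<open>log_potential_limit\<close>).
  \<^item> Expanding the logarithm for large \<open>z\<close>, these means determine the limits of all moments, and by
    Weierstrass those of all continuous functions on a compact interval
    (\<open>vanishing_functionals.continuous_null\<close>).
  \<^item> Helly's selection theorem yields one limit measure along one sequence.  The rescaled zeros are at
    least \<open>1/N\<close> apart, so the limiting distribution function is Lipschitz with constant \<open>1/c\<close> and the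
    Radon-Nikodym theorem provides the density (\<open>separated_points_have_limit_density\<close>).
\<close>

section \<open>The raising operator of a Poisson weight\<close>

text \<open>
  For \<open>b \<noteq> 0\<close> this is \<open>- b\<close> times the operator \<open>P \<mapsto> w\<^sup>-\<^sup>1 \<nabla> (w P)\<close> of the Rodrigues formula,
  where \<open>w(x) = b^x / x!\<close> and \<open>\<nabla>\<close> is the backward difference.
\<close>

definition poisson_raise :: "real \<Rightarrow> real poly \<Rightarrow> real poly" where
  "poisson_raise b P = [:0, 1:] * pcompose P [:-1, 1:] - smult b P"

definition poisson_sum :: "real \<Rightarrow> real poly \<Rightarrow> real" where
  "poisson_sum c P = (\<Sum>k. poly P (real k) * (c ^ k / fact k))"

lemma poly_poisson_raise: "poly (poisson_raise b P) x = x * poly P (x - 1) - b * poly P x"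
  by (simp add: poisson_raise_def poly_pcompose)

lemma poisson_raise_add: "poisson_raise b (P + Q) = poisson_raise b P + poisson_raise b Q"
  by (simp add: poly_eq_poly_eq_iff [symmetric] fun_eq_iff poly_poisson_raise algebra_simps)

lemma poisson_raise_smult: "poisson_raise b (smult c P) = smult c (poisson_raise b P)"
  by (simp add: poly_eq_poly_eq_iff [symmetric] fun_eq_iff poly_poisson_raise algebra_simps)

lemma poisson_raise_0 [simp]: "poisson_raise b 0 = 0"
  by (simp add: poisson_raise_def)

lemma poisson_raise_commute:
  "poisson_raise b (poisson_raise c P) = poisson_raise c (poisson_raise b P)"
  by (simp add: poly_eq_poly_eq_iff [symmetric] fun_eq_iff poly_poisson_raise algebra_simps)

lemma degree_lead_coeff_poisson_raise:
  assumes "P \<noteq> 0"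
  shows "degree (poisson_raise b P) = Suc (degree P)"
    and "lead_coeff (poisson_raise b P) = lead_coeff P"
proof -
  let ?S = "[:0, 1:] * pcompose P [:-1, 1:]"
  have nz: "pcompose P [:-1, 1:] \<noteq> 0"
    using assms by (simp add: pcompose_eq_0_iff)
  have dS: "degree ?S = Suc (degree P)"
    using nz by (simp add: degree_pcompose)
  have lS: "lead_coeff ?S = lead_coeff P"
    by (subst lead_coeff_mult) (simp add: lead_coeff_comp)
  have lt: "degree (smult b P) < degree ?S"
    unfolding dS by (simp add: degree_smult_le le_imp_less_Suc)
  show d: "degree (poisson_raise b P) = Suc (degree P)"
    unfolding poisson_raise_def diff_conv_add_uminus
    using lt dS by (subst degree_add_eq_left) auto
  show "lead_coeff (poisson_raise b P) = lead_coeff P"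
    unfolding d unfolding poisson_raise_def coeff_diff
    using lS lt unfolding dS by (simp add: coeff_eq_0)
qed

lemma poisson_weight_Suc:
  "real (Suc k) * u * (c ^ Suc k / fact (Suc k)) = c * (u * (c ^ k / fact k))" for c u :: real
  by (simp add: field_simps del: of_nat_Suc)

text \<open>
  Since \<open>k c^k / k! = c c^(k - 1) / (k - 1)!\<close>, splitting off the constant coefficient and shifting
  the summation index lowers the degree of the polynomial.
\<close>

lemma summable_poisson: "summable (\<lambda>k. poly P (real k) * (c ^ k / fact k))"
proof (induction "degree P" arbitrary: P rule: less_induct)
  case less
  obtain u Q where P: "P = pCons u Q" by (cases P)
  have exp: "summable (\<lambda>k. u * (c ^ k / fact k))"
    by (intro summable_mult) (use summable_exp [of c] in \<open>simp add: field_simps\<close>)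
  have "summable (\<lambda>k. real k * poly Q (real k) * (c ^ k / fact k))"
  proof (cases "Q = 0")
    case False
    define Q' where "Q' = pcompose Q [:1, 1:]"
    have "degree Q' < degree P"
      unfolding Q'_def degree_pcompose P using False by simp
    then have "summable (\<lambda>k. poly Q' (real k) * (c ^ k / fact k))"
      by (rule less)
    then have "summable (\<lambda>k. c * (poly Q' (real k) * (c ^ k / fact k)))"
      by (rule summable_mult)
    also have "(\<lambda>k. c * (poly Q' (real k) * (c ^ k / fact k))) =
        (\<lambda>k. real (Suc k) * poly Q (real (Suc k)) * (c ^ Suc k / fact (Suc k)))"
    proof
      fix k
      have "poly Q' (real k) = poly Q (real (Suc k))"
        by (simp add: Q'_def poly_pcompose add.commute)
      then show "c * (poly Q' (real k) * (c ^ k / fact k)) =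
          real (Suc k) * poly Q (real (Suc k)) * (c ^ Suc k / fact (Suc k))"
        by (simp only: poisson_weight_Suc)
    qed
    finally show ?thesis
      using summable_Suc_iff [of "\<lambda>k. real k * poly Q (real k) * (c ^ k / fact k)"] by blast
  qed simp
  from summable_add [OF exp this] show ?case
    by (simp add: P algebra_simps)
qed

lemma poisson_sum_sums: "(\<lambda>k. poly P (real k) * (c ^ k / fact k)) sums poisson_sum c P"
  using summable_poisson unfolding poisson_sum_def by blast

lemma poisson_sum_add: "poisson_sum c (P + Q) = poisson_sum c P + poisson_sum c Q"
  unfolding poisson_sum_def
  by (subst suminf_add [OF summable_poisson summable_poisson]) (simp add: algebra_simps)

lemma poisson_sum_smult: "poisson_sum c (smult u P) = u * poisson_sum c P"
  unfolding poisson_sum_def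
  by (subst suminf_mult [OF summable_poisson, symmetric]) (simp add: algebra_simps)

lemma poisson_sum_diff: "poisson_sum c (P - Q) = poisson_sum c P - poisson_sum c Q"
  using poisson_sum_add [of c "P - Q" Q] by simp

lemma poisson_sum_0 [simp]: "poisson_sum c 0 = 0"
  by (simp add: poisson_sum_def)

lemma poisson_sum_const: "poisson_sum c [:u:] = u * exp c"
  using poisson_sum_sums [of "[:u:]" c] sums_mult [OF exp_converges [of c], of u]
  by (auto simp: sums_iff field_simps scaleR_conv_of_real)

lemma poisson_sum_shift:
  "poisson_sum c ([:0, 1:] * pcompose R [:-1, 1:]) = c * poisson_sum c R"
proof -
  let ?P = "[:0, 1:] * pcompose R [:-1, 1:]"
  let ?g = "\<lambda>k. poly ?P (real k) * (c ^ k / fact k)"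
  have "(\<lambda>k. c * (poly R (real k) * (c ^ k / fact k))) sums (c * poisson_sum c R)"
    by (intro sums_mult poisson_sum_sums)
  also have "(\<lambda>k. c * (poly R (real k) * (c ^ k / fact k))) = (\<lambda>k. ?g (Suc k))"
  proof
    fix k
    have "poly ?P (real (Suc k)) = real (Suc k) * poly R (real k)"
      by (simp add: poly_pcompose)
    then show "c * (poly R (real k) * (c ^ k / fact k)) = ?g (Suc k)"
      by (simp only: poisson_weight_Suc)
  qed
  finally have "?g sums (c * poisson_sum c R + ?g 0)"
    by (subst (asm) sums_Suc_iff) simp
  then show ?thesis
    using poisson_sum_sums [of ?P c] by (simp add: sums_iff)
qed

text \<open>
  Summation by parts, in the form that moves the raising operator onto the test polynomial.
\<close>

lemma poisson_sum_raise:
  "poisson_sum c (Q * poisson_raise b E) =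
     poisson_sum c ((smult c (pcompose Q [:1, 1:]) - smult b Q) * E)"
proof -
  have eq: "Q * poisson_raise b E =
      [:0, 1:] * pcompose (pcompose Q [:1, 1:] * E) [:-1, 1:] - smult b (Q * E)"
    by (simp add: poly_eq_poly_eq_iff [symmetric] fun_eq_iff poly_poisson_raise poly_pcompose
        algebra_simps)
  have "poisson_sum c (Q * poisson_raise b E) =
      c * poisson_sum c (pcompose Q [:1, 1:] * E) - b * poisson_sum c (Q * E)"
    unfolding eq poisson_sum_diff poisson_sum_shift poisson_sum_smult ..
  then show ?thesis
    by (simp add: left_diff_distrib poisson_sum_diff poisson_sum_smult)
qed

section \<open>Orthogonality and uniqueness\<close>

definition poisson_orth :: "real \<Rightarrow> nat \<Rightarrow> real poly \<Rightarrow> bool" where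
  "poisson_orth c n P \<longleftrightarrow> (\<forall>l<n. poisson_sum c (monom 1 l * P) = 0)"

lemma poisson_orth_iff_sums:
  "poisson_orth c n P \<longleftrightarrow>
     (\<forall>l<n. (\<lambda>k. poly P (real k) * real k ^ l * (c ^ k / fact k)) sums 0)"
proof -
  have "poisson_sum c (monom 1 l * P) = 0 \<longleftrightarrow>
      (\<lambda>k. poly P (real k) * real k ^ l * (c ^ k / fact k)) sums 0" for l
    using poisson_sum_sums [of "monom 1 l * P" c]
    by (auto simp: sums_iff poly_monom mult_ac)
  then show ?thesis by (simp add: poisson_orth_def)
qed

text \<open>
  The condition on \<open>Q\<close> says that its degree is below \<open>n\<close>, and also covers \<open>n = 0\<close>, where it
  forces \<open>Q = 0\<close>.
\<close>

lemma poisson_orthD: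
  assumes "poisson_orth c n P" and "\<And>i. i \<ge> n \<Longrightarrow> coeff Q i = 0"
  shows "poisson_sum c (Q * P) = 0"
proof -
  have "poisson_sum c ((\<Sum>i\<le>d. monom (coeff Q i) i) * P) = 0" for d
  proof (induction d)
    case 0
    have "poisson_sum c (monom (coeff Q 0) 0 * P) = coeff Q 0 * poisson_sum c (monom 1 0 * P)"
      by (simp add: monom_0 poisson_sum_smult)
    then show ?case using assms
      by (cases "n = 0") (auto simp: poisson_orth_def)
  next
    case (Suc d)
    have "monom (coeff Q (Suc d)) (Suc d) = smult (coeff Q (Suc d)) (monom 1 (Suc d))"
      by (simp add: smult_monom)
    then have "poisson_sum c (monom (coeff Q (Suc d)) (Suc d) * P) =
        coeff Q (Suc d) * poisson_sum c (monom 1 (Suc d) * P)"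
      by (simp add: poisson_sum_smult)
    also have "\<dots> = 0"
      using assms by (cases "Suc d < n") (auto simp: poisson_orth_def)
    finally show ?case using Suc by (simp add: distrib_right poisson_sum_add)
  qed
  from this [of "degree Q"] show ?thesis by (simp add: poly_as_sum_of_monoms)
qed

text \<open>
  The difference operator that \<open>poisson_sum_raise\<close> applies to a monomial has leading term
  \<open>(c - b) x^l\<close> if \<open>b \<noteq> c\<close> and \<open>c l x^(l - 1)\<close> if \<open>b = c\<close>; both can be read off here.
\<close>

lemma coeff_shift_monom:
  fixes b c :: real
  defines "D \<equiv> \<lambda>l. smult c (pcompose (monom 1 l) [:1, 1:]) - smult b (monom 1 l)"
  shows "coeff (D l) i = (if i \<le> l then c * real (l choose i) else 0) - (if i = l then b else 0)"
proof -
  have "pcompose (monom 1 l) [:1, 1:] = [:1, 1 :: real:] ^ l"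
    by (simp add: poly_eq_poly_eq_iff [symmetric] fun_eq_iff poly_pcompose poly_monom)
  moreover have "coeff ([:1, 1 :: real:] ^ l) i = (if i \<le> l then real (l choose i) else 0)"
  proof (cases "i \<le> l")
    case True
    then show ?thesis using coeff_linear_poly_power [of i l 1 "1::real"]
      by (simp)
  next
    case False
    have "degree ([:1, 1 :: real:] ^ l) \<le> l"
      using degree_power_le [of "[:1, 1 :: real:]" l] by simp
    then show ?thesis using False by (simp add: coeff_eq_0)
  qed
  ultimately show ?thesis by (simp add: D_def)
qed

text \<open>
  For \<open>b \<noteq> c\<close> the difference operator on test polynomials is triangular with nonzero diagonal
  \<open>c - b\<close>, so the monomials can be recovered one after the other.
\<close>

lemma poisson_orth_raise_other:
  assumes "b \<noteq> c"
  shows "poisson_orth c n (poisson_raise b E) \<longleftrightarrow> poisson_orth c n E"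
proof
  assume E: "poisson_orth c n E"
  show "poisson_orth c n (poisson_raise b E)"
    unfolding poisson_orth_def poisson_sum_raise
  proof (intro allI impI poisson_orthD [OF E])
    fix l i assume "l < n" "n \<le> i"
    then show "coeff (smult c (pcompose (monom 1 l) [:1, 1:]) - smult b (monom 1 l)) i = 0"
      unfolding coeff_shift_monom by auto
  qed
next
  assume L: "poisson_orth c n (poisson_raise b E)"
  have "poisson_orth c l E" if "l \<le> n" for l
    using that
  proof (induction l)
    case (Suc l)
    let ?D = "smult c (pcompose (monom 1 l) [:1, 1:]) - smult b (monom 1 l)"
    have IH: "poisson_orth c l E" using Suc by simp
    have "poisson_sum c ((?D - smult (c - b) (monom 1 l)) * E) = 0"
      by (rule poisson_orthD [OF IH]) (auto simp: coeff_shift_monom simp del: coeff_diff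
          simp add: coeff_diff [of ?D])
    moreover have "poisson_sum c (?D * E) = 0"
      using L Suc.prems unfolding poisson_orth_def poisson_sum_raise by simp
    ultimately have "(c - b) * poisson_sum c (monom 1 l * E) = 0"
      by (simp only: left_diff_distrib [of ?D] poisson_sum_diff mult_smult_left poisson_sum_smult)
    with assms IH show ?case
      by (simp add: poisson_orth_def less_Suc_eq)
  qed (simp add: poisson_orth_def)
  then show "poisson_orth c n E" by simp
qed

text \<open>
  Here the difference operator sends \<open>x^(l + 1)\<close> to \<open>c (l + 1) x^l\<close> plus lower terms, so one
  relation is lost in passing from the raised polynomial to \<open>E\<close>.
\<close>

lemma poisson_orth_raise_same:
  assumes "c \<noteq> 0" and L: "poisson_orth c (Suc n) (poisson_raise c E)"
  shows "poisson_orth c n E"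
proof -
  have "poisson_orth c l E" if "l \<le> n" for l
    using that
  proof (induction l)
    case (Suc l)
    let ?D = "smult c (pcompose (monom 1 (Suc l)) [:1, 1:]) - smult c (monom 1 (Suc l))"
    have IH: "poisson_orth c l E" using Suc by simp
    have "poisson_sum c ((?D - smult (c * real (Suc l)) (monom 1 l)) * E) = 0"
      by (rule poisson_orthD [OF IH])
        (auto simp: coeff_shift_monom le_Suc_eq simp del: coeff_diff binomial_Suc_Suc
          simp add: coeff_diff [of ?D])
    moreover have "poisson_sum c (?D * E) = 0"
      using L Suc.prems unfolding poisson_orth_def poisson_sum_raise by simp
    ultimately have "(c * real (Suc l)) * poisson_sum c (monom 1 l * E) = 0"
      by (simp only: left_diff_distrib [of ?D] poisson_sum_diff mult_smult_left poisson_sum_smult)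
    with assms(1) IH show ?case
      by (simp add: poisson_orth_def less_Suc_eq)
  qed (simp add: poisson_orth_def)
  then show ?thesis by simp
qed

lemma poisson_orth_raise_SucI:
  assumes E: "poisson_orth c n E"
  shows "poisson_orth c (Suc n) (poisson_raise c E)"
  unfolding poisson_orth_def poisson_sum_raise
proof (intro allI impI poisson_orthD [OF E])
  fix l i assume "l < Suc n" "n \<le> i"
  then show "coeff (smult c (pcompose (monom 1 l) [:1, 1:]) - smult c (monom 1 l)) i = 0"
    unfolding coeff_shift_monom by auto
qed

text \<open>
  Raising increases the degree by exactly one, so the range of the raising operator together with
  the constants is everything.
\<close>

lemma poisson_raise_plus_const:
  "\<exists>E u. P = poisson_raise b E + [:u:] \<and> (E = 0 \<or> degree P = Suc (degree E))"
proof (induction "degree P" arbitrary: P rule: less_induct)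
  case less
  show ?case
  proof (cases "degree P")
    case 0
    then obtain u where "P = [:u:]" by (rule degree_eq_zeroE)
    then show ?thesis by (intro exI [of _ 0] exI [of _ u]) simp
  next
    case (Suc d)
    define M where "M = monom (lead_coeff P) d"
    have "P \<noteq> 0" using Suc by auto
    then have nz: "M \<noteq> 0" by (simp add: M_def)
    have dM: "degree M = d" unfolding M_def using \<open>P \<noteq> 0\<close> by (intro degree_monom_eq) auto
    have lM: "lead_coeff M = lead_coeff P"
      using dM by (simp add: M_def)
    let ?R = "poisson_raise b M"
    have dR: "degree ?R = degree P" and lR: "lead_coeff ?R = lead_coeff P"
      using degree_lead_coeff_poisson_raise [OF nz, of b] dM lM Suc by auto
    have "degree (P - ?R) < degree P"
    proof (rule degree_lessI)
      show "P - ?R \<noteq> 0 \<or> 0 < degree P" using Suc by simp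
      show "\<forall>k\<ge>degree P. coeff (P - ?R) k = 0"
      proof (intro allI impI)
        fix k assume "degree P \<le> k"
        then show "coeff (P - ?R) k = 0"
          using lR unfolding dR by (cases "k = degree P") (simp_all add: dR coeff_eq_0)
      qed
    qed
    from less [OF this] obtain E u where E: "P - ?R = poisson_raise b E + [:u:]"
      "E = 0 \<or> degree (P - ?R) = Suc (degree E)" by blast
    have "degree E < degree M \<or> E = 0"
      using E(2) \<open>degree (P - ?R) < degree P\<close> unfolding Suc dM by linarith
    then have "degree (M + E) = d"
      using dM degree_add_eq_left [of E M] by auto
    moreover have "P = poisson_raise b (M + E) + [:u:]"
      using E(1) by (simp add: poisson_raise_add algebra_simps)
    ultimately have "P = poisson_raise b (M + E) + [:u:] \<and> degree P = Suc (degree (M + E))"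
      using Suc by simp
    then show ?thesis by blast
  qed
qed

text \<open>
  This yields uniqueness.  Write \<open>P\<close> as in \<open>poisson_raise_plus_const\<close> with \<open>b = b i\<close>.  The Poisson sum
  of the raised part is 0 and that of the constant \<open>u\<close> is \<open>u exp (b i)\<close>, so orthogonality to 1 forces
  \<open>u = 0\<close>.  Hence \<open>P\<close> is
  itself a raised polynomial, and the preimage satisfies the same relations with \<open>m i\<close> decreased by
  one.
\<close>

lemma multiple_orth_eq_0:
  fixes b :: "nat \<Rightarrow> real"
  assumes "inj_on b {1..r}" and "\<And>j. j \<in> {1..r} \<Longrightarrow> 0 < b j"
    and "\<And>j. j \<in> {1..r} \<Longrightarrow> poisson_orth (b j) (m j) P"
    and "P = 0 \<or> degree P < (\<Sum>j=1..r. m j)"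
  shows "P = 0"
  using assms(3,4)
proof (induction "\<Sum>j=1..r. m j" arbitrary: m P)
  case (Suc s)
  from Suc.hyps(2) obtain i where i: "i \<in> {1..r}" "m i \<noteq> 0"
    by (metis nat.distinct(1) sum.neutral)
  then obtain k where k: "m i = Suc k" by (cases "m i") auto
  obtain E u where E: "P = poisson_raise (b i) E + [:u:]" "E = 0 \<or> degree P = Suc (degree E)"
    using poisson_raise_plus_const by blast
  have "poisson_sum (b i) (monom 1 0 * P) = 0"
    using Suc.prems(1) [OF i(1)] k unfolding poisson_orth_def
    by (metis zero_less_Suc)
  then have "poisson_sum (b i) (1 * poisson_raise (b i) E) + poisson_sum (b i) [:u:] = 0"
    by (simp add: E(1) poisson_sum_add monom_0)
  then have "u = 0"
    unfolding poisson_sum_raise poisson_sum_const by (simp add: pcompose_1)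
  with E have PE: "P = poisson_raise (b i) E" by simp
  define m' where "m' = m(i := k)"
  have sum: "(\<Sum>j=1..r. m j) = Suc (\<Sum>j=1..r. m' j)"
  proof -
    have "(\<Sum>j=1..r. m j) = m i + (\<Sum>j\<in>{1..r} - {i}. m j)"
      using i by (subst sum.remove [of _ i]) auto
    moreover have "(\<Sum>j=1..r. m' j) = m' i + (\<Sum>j\<in>{1..r} - {i}. m' j)"
      using i by (subst sum.remove [of _ i]) auto
    moreover have "(\<Sum>j\<in>{1..r} - {i}. m' j) = (\<Sum>j\<in>{1..r} - {i}. m j)"
      by (intro sum.cong) (auto simp: m'_def)
    ultimately show ?thesis using k by (simp add: m'_def)
  qed
  have "E = 0"
  proof (rule Suc.hyps(1))
    show "s = (\<Sum>j=1..r. m' j)" using sum Suc.hyps(2) by simp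
    show "E = 0 \<or> degree E < (\<Sum>j=1..r. m' j)"
    proof (cases "E = 0")
      case False
      with E(2) have "degree P = Suc (degree E)" by simp
      moreover from this have "P \<noteq> 0" by auto
      ultimately show ?thesis using Suc.prems(2) sum by simp
    qed simp
  next
    fix j assume j: "j \<in> {1..r}"
    show "poisson_orth (b j) (m' j) E"
    proof (cases "j = i")
      case True
      then show ?thesis using Suc.prems(1) [OF j] assms(2) [OF j] k PE
        by (auto simp: m'_def intro!: poisson_orth_raise_same)
    next
      case False
      then have "b i \<noteq> b j" using assms(1) i j by (auto dest: inj_onD)
      then show ?thesis using Suc.prems(1) [OF j] False PE
        by (simp add: m'_def poisson_orth_raise_other)
    qed
  qed
  then show ?case using PE by simp
qed simp

lemma foldr_poisson_raise_monic:
  assumes "lead_coeff P = 1"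
  shows "lead_coeff (foldr poisson_raise bs P) = 1 \<and>
    degree (foldr poisson_raise bs P) = degree P + length bs"
proof (induction bs)
  case Nil
  show ?case using assms by simp
next
  case (Cons b bs)
  define R where "R = foldr poisson_raise bs P"
  have R: "lead_coeff R = 1" "degree R = degree P + length bs" using Cons by (auto simp: R_def)
  then have "R \<noteq> 0" by auto
  from degree_lead_coeff_poisson_raise [OF this, of b] R
  have "lead_coeff (poisson_raise b R) = 1" "degree (poisson_raise b R) = Suc (degree P + length bs)"
    by simp_all
  then show ?case unfolding foldr_Cons comp_apply R_def [symmetric] by simp
qed

lemma foldr_poisson_raise_orth:
  "poisson_orth c (count_list bs c) (foldr poisson_raise bs P)"
proof (induction bs)
  case Nil
  show ?case by (simp add: poisson_orth_def)
next
  case (Cons b bs)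
  then show ?case
    by (cases "b = c") (simp_all add: poisson_orth_raise_other poisson_orth_raise_SucI)
qed

text \<open>
  The parameters, each repeated with its multiplicity.  The last block comes last, so that a right
  fold applies the operators of the parameter \<open>b r\<close> first.
\<close>

definition charlier_params :: "nat \<Rightarrow> (nat \<Rightarrow> real) \<Rightarrow> (nat \<Rightarrow> nat) \<Rightarrow> real list" where
  "charlier_params r b m = concat (map (\<lambda>j. replicate (m j) (b j)) [1..<Suc r])"

lemma length_charlier_params: "length (charlier_params r b m) = mi_size r m"
  by (induction r) (simp_all add: charlier_params_def mi_size_def)

lemma count_list_replicate_eq: "x = c \<Longrightarrow> count_list (replicate n x) c = n"
  by (induction n) auto

lemma count_charlier_params:
  assumes "j \<in> {1..r}"
  shows "m j \<le> count_list (charlier_params r b m) (b j)"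
  using assms
proof (induction r)
  case (Suc r)
  then show ?case
    by (cases "j = Suc r") (auto simp: charlier_params_def count_list_replicate_eq)
qed simp

lemma is_multiple_charlier_unique:
  assumes "inj_on b {1..r}" and "\<And>j. j \<in> {1..r} \<Longrightarrow> 0 < b j"
    and P: "is_multiple_charlier r b m P" and Q: "is_multiple_charlier r b m Q"
  shows "P = Q"
proof -
  have orth: "poisson_orth (b j) (m j) P" "poisson_orth (b j) (m j) Q" if "j \<in> {1..r}" for j
    using P Q that by (auto simp: is_multiple_charlier_def poisson_orth_iff_sums)
  have "P - Q = 0"
  proof (rule multiple_orth_eq_0 [OF assms(1,2)])
    show "poisson_orth (b j) (m j) (P - Q)" if "j \<in> {1..r}" for j
      using orth [OF that] by (simp add: poisson_orth_def right_diff_distrib poisson_sum_diff)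
    show "P - Q = 0 \<or> degree (P - Q) < (\<Sum>j=1..r. m j)"
    proof (cases "(\<Sum>j=1..r. m j) = 0")
      case True
      with P Q have "degree P = 0" "lead_coeff P = 1" "degree Q = 0" "lead_coeff Q = 1"
        by (auto simp: is_multiple_charlier_def mi_size_def)
      then have "P = Q" by (auto elim!: degree_eq_zeroE)
      then show ?thesis by simp
    next
      case False
      have "coeff (P - Q) k = 0" if "k \<ge> (\<Sum>j=1..r. m j)" for k
        using P Q that unfolding is_multiple_charlier_def mi_size_def
        by (cases "k = (\<Sum>j=1..r. m j)") (auto simp: coeff_eq_0)
      moreover have "0 < (\<Sum>j=1..r. m j)" using False by (simp only: neq0_conv)
      ultimately have "degree (P - Q) < (\<Sum>j=1..r. m j)" by (intro degree_lessI disjI2) blast+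
      then show ?thesis ..
    qed
  qed auto
  then show ?thesis by simp
qed

lemma multiple_charlier_eq:
  assumes "inj_on b {1..r}" and "\<And>j. j \<in> {1..r} \<Longrightarrow> 0 < b j"
  shows "multiple_charlier r b m = foldr poisson_raise (charlier_params r b m) 1"
proof -
  have "is_multiple_charlier r b m (foldr poisson_raise (charlier_params r b m) 1)"
    unfolding is_multiple_charlier_def
  proof (intro conjI ballI)
    fix j assume j: "j \<in> {1..r}"
    have "poisson_orth (b j) (m j) (foldr poisson_raise (charlier_params r b m) 1)"
      using foldr_poisson_raise_orth [of "b j" "charlier_params r b m" 1]
        count_charlier_params [OF j, of m b]
      unfolding poisson_orth_def by (meson less_le_trans)
    then show "\<forall>l<m j. (\<lambda>k. poly (foldr poisson_raise (charlier_params r b m) 1) (real k) *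
        real k ^ l * (b j ^ k / fact k)) sums 0"
      unfolding poisson_orth_iff_sums .
  qed (use foldr_poisson_raise_monic [of 1 "charlier_params r b m"] length_charlier_params in auto)
  then show ?thesis
    unfolding multiple_charlier_def
    using is_multiple_charlier_unique [OF assms] by (intro the_equality) auto
qed

section \<open>Polynomials whose zeros are separated by at least one\<close>

definition mesh_zeros :: "nat \<Rightarrow> (nat \<Rightarrow> real) \<Rightarrow> real poly \<Rightarrow> bool" where
  "mesh_zeros n x P \<longleftrightarrow> P = (\<Prod>i<n. [:- x i, 1:]) \<and> (\<forall>i<n. 0 \<le> x i) \<and>
     (\<forall>i. Suc i < n \<longrightarrow> x i + 1 \<le> x (Suc i))"

lemma mesh_zerosD:
  assumes "mesh_zeros n x P"
  shows "P = (\<Prod>i<n. [:- x i, 1:])" and "\<And>u. poly P u = (\<Prod>i<n. u - x i)"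
    and "\<And>i. i < n \<Longrightarrow> 0 \<le> x i" and "\<And>i. Suc i < n \<Longrightarrow> x i + 1 \<le> x (Suc i)"
  using assms by (auto simp: mesh_zeros_def poly_prod)

lemma mesh_gap:
  fixes x :: "nat \<Rightarrow> real"
  assumes "\<And>i. Suc i < n \<Longrightarrow> x i + 1 \<le> x (Suc i)" and "i \<le> j" "j < n"
  shows "x i + real (j - i) \<le> x j"
  using assms(2,3)
proof (induction j)
  case (Suc j)
  show ?case
  proof (cases "i = Suc j")
    case False
    then have "x i + real (j - i) \<le> x j" "x j + 1 \<le> x (Suc j)" "i \<le> j"
      using Suc assms(1) by auto
    then show ?thesis by (simp add: Suc_diff_le)
  qed simp
qed simp

lemma mesh_zeros_gap:
  assumes "mesh_zeros n x P" "i \<le> j" "j < n"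
  shows "x i + real (j - i) \<le> x j"
  using mesh_gap [of n x i j] mesh_zerosD(4) [OF assms(1)] assms(2,3) by blast

lemma mesh_zeros_monic:
  assumes "mesh_zeros n x P"
  shows "degree P = n" "lead_coeff P = 1"
proof -
  show "degree P = n"
    unfolding mesh_zerosD(1) [OF assms] by (subst degree_prod_eq_sum_degree) auto
  show "lead_coeff P = 1"
    unfolding mesh_zerosD(1) [OF assms] lead_coeff_prod by simp
qed

lemma mesh_zeros_enum:
  assumes "mesh_zeros n x P"
  shows "sorted_list_of_set {u. poly P u = 0} = map x [0..<n]"
proof -
  have lt: "x i < x j" if "i < j" "j < n" for i j
    using mesh_zeros_gap [OF assms, of i j] that by simp
  have "set (map x [0..<n]) = {u. poly P u = 0}"
    by (auto simp: mesh_zerosD(2) [OF assms])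
  moreover have "sorted_wrt (<) (map x [0..<n])"
    by (auto simp: sorted_wrt_iff_nth_less lt)
  ultimately show ?thesis
    by (metis strict_sorted_equal sorted_list_of_set.set_sorted_key_list_of_set
        sorted_list_of_set.strict_sorted_key_list_of_set finite_set)
qed

lemma mesh_zeros_unique:
  assumes "mesh_zeros n x P" "mesh_zeros n y P" "i < n"
  shows "x i = y i"
proof -
  have "map x [0..<n] = map y [0..<n]"
    using mesh_zeros_enum assms by metis
  with assms(3) show ?thesis by simp
qed

text \<open>
  The sign of a product of linear factors is determined by the number of zeros to the right.  Weak
  inequalities are essential: adjacent zeros at distance exactly 1 do occur.
\<close>

lemma sign_between_zeros:
  fixes x :: "nat \<Rightarrow> real"
  assumes "i \<le> n" and "\<And>j. j < i \<Longrightarrow> x j \<le> u" and "\<And>j. i \<le> j \<Longrightarrow> j < n \<Longrightarrow> u \<le> x j"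
  shows "0 \<le> (-1) ^ (n - i) * (\<Prod>j<n. u - x j)"
proof -
  have "{..<n} = {..<i} \<union> {i..<n}" using assms(1) by auto
  then have "(\<Prod>j<n. u - x j) = (\<Prod>j<i. u - x j) * (\<Prod>j=i..<n. u - x j)"
    by (simp add: prod.union_disjoint ivl_disj_int)
  moreover have "(\<Prod>j=i..<n. u - x j) = (-1) ^ (n - i) * (\<Prod>j=i..<n. x j - u)"
    using prod.distrib [of "\<lambda>_. -1" "\<lambda>j. x j - u" "{i..<n}"] by simp
  ultimately have "(-1) ^ (n - i) * (\<Prod>j<n. u - x j) =
      (\<Prod>j<i. u - x j) * (\<Prod>j=i..<n. x j - u) * ((-1) ^ (n - i) * (-1) ^ (n - i))"
    by (simp add: mult_ac)
  also have "\<dots> = (\<Prod>j<i. u - x j) * (\<Prod>j=i..<n. x j - u)"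
    by (simp flip: power_mult_distrib)
  also have "\<dots> \<ge> 0"
    using assms(2,3) by (intro mult_nonneg_nonneg prod_nonneg) auto
  finally show ?thesis .
qed

lemma root_of_weak_sign_change:
  fixes P :: "real poly"
  assumes "lo \<le> hi" "s * poly P lo \<le> 0" "0 \<le> s * poly P hi" "s \<noteq> 0"
  shows "\<exists>u. lo \<le> u \<and> u \<le> hi \<and> poly P u = 0"
proof -
  have "continuous_on {lo..hi} (\<lambda>u. s * poly P u)"
    by (intro continuous_intros)
  from IVT' [of "\<lambda>u. s * poly P u" lo 0 hi, OF assms(2,3,1) this] assms(4)
  show ?thesis by auto
qed

text \<open>
  The zeros of \<open>S P\<close>: the raised polynomial has one zero between \<open>gap_left x i\<close> and \<open>x i\<close>, and a
  last one to the right of \<open>gap_left x n\<close>.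
\<close>

definition gap_left :: "(nat \<Rightarrow> real) \<Rightarrow> nat \<Rightarrow> real" where
  "gap_left x i = (if i = 0 then 0 else x (i - 1) + 1)"

lemma sign_in_gap:
  assumes "mesh_zeros n x P" "i \<le> n" and "i > 0 \<Longrightarrow> x (i - 1) \<le> u" and "i < n \<Longrightarrow> u \<le> x i"
  shows "0 \<le> (-1) ^ (n - i) * poly P u"
  unfolding mesh_zerosD(2) [OF assms(1)]
proof (rule sign_between_zeros [OF assms(2)])
  fix j assume "j < i"
  then show "x j \<le> u"
    using mesh_zeros_gap [OF assms(1), of j "i - 1"] assms(2,3)
    by (force simp del: of_nat_diff)
next
  fix j assume "i \<le> j" "j < n"
  then show "u \<le> x j"
    using mesh_zeros_gap [OF assms(1), of i j] assms(4) by auto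
qed

lemma poly_raise_gap_left:
  assumes "mesh_zeros n x P" "i \<le> n"
  shows "poly (poisson_raise b P) (gap_left x i) = - b * poly P (gap_left x i)"
proof (cases i)
  case (Suc j)
  then have "poly P (x j) = 0" using assms by (auto simp: mesh_zerosD(2))
  then show ?thesis using Suc by (simp add: poly_poisson_raise gap_left_def)
qed (simp add: poly_poisson_raise gap_left_def)

lemma sign_gap_left:
  assumes "mesh_zeros n x P" "i \<le> n"
  shows "0 \<le> (-1) ^ (n - i) * poly P (gap_left x i)"
  using assms
proof (rule sign_in_gap)
  show "i < n \<Longrightarrow> gap_left x i \<le> x i"
    using mesh_zerosD(3,4) [OF assms(1)] by (cases i) (auto simp: gap_left_def)
qed (auto simp: gap_left_def)

lemma gap_left_le: "mesh_zeros n x P \<Longrightarrow> i < n \<Longrightarrow> gap_left x i \<le> x i"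
  using mesh_zerosD(3,4) by (cases i) (auto simp: gap_left_def)

lemma sign_raise_gap_left:
  assumes "mesh_zeros n x P" "i \<le> n" "0 \<le> b"
  shows "(-1) ^ (n - i) * poly (poisson_raise b P) (gap_left x i) \<le> 0"
  using mult_nonneg_nonneg [OF assms(3) sign_gap_left [OF assms(1,2)]]
  by (simp add: poly_raise_gap_left [OF assms(1,2)] mult_ac)

text \<open>
  The intervals from \<open>gap_left x i\<close> to \<open>x i\<close> are disjoint because \<open>x i < x i + 1\<close>, so one root in
  each of them accounts for the whole degree.
\<close>

lemma mesh_zeros_raiseI:
  assumes P: "mesh_zeros n x P"
    and lo: "\<And>i. i \<le> n \<Longrightarrow> gap_left x i \<le> y i" and hi: "\<And>i. i < n \<Longrightarrow> y i \<le> x i"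
    and root: "\<And>i. i \<le> n \<Longrightarrow> poly (poisson_raise b P) (y i) = 0"
  shows "mesh_zeros (Suc n) y (poisson_raise b P)"
  unfolding mesh_zeros_def
proof (intro conjI allI impI)
  show step: "y i + 1 \<le> y (Suc i)" if "Suc i < Suc n" for i
    using lo [of "Suc i"] hi [of i] that by (simp add: gap_left_def)
  show "0 \<le> y i" if "i < Suc n" for i
    using lo [of i] mesh_zerosD(3) [OF P, of "i - 1"] that
    by (cases i) (auto simp: gap_left_def)
  have inj: "inj_on y {..<Suc n}"
  proof (rule linorder_inj_onI)
    show "y i \<noteq> y j" if "i < j" "i \<in> {..<Suc n}" "j \<in> {..<Suc n}" for i j
      using mesh_gap [of "Suc n" y i j] step that by fastforce
  qed auto
  have nz: "P \<noteq> 0" using mesh_zeros_monic [OF P] by auto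
  have dl: "degree (poisson_raise b P) = Suc n" "lead_coeff (poisson_raise b P) = 1"
    using degree_lead_coeff_poisson_raise [OF nz, of b] mesh_zeros_monic [OF P] by auto
  let ?R = "\<Prod>i<Suc n. [:- y i, 1:]"
  have dR: "degree ?R = Suc n" by (subst degree_prod_eq_sum_degree) auto
  have lR: "lead_coeff ?R = 1" unfolding lead_coeff_prod by simp
  show "poisson_raise b P = ?R"
  proof (rule poly_eqI_degree_lead_coeff [where n = "Suc n" and A = "y ` {..<Suc n}"])
    show "coeff (poisson_raise b P) (Suc n) = coeff ?R (Suc n)"
      using dl dR lR by metis
    show "Suc n \<le> card (y ` {..<Suc n})" using inj by (simp add: card_image)
    fix z assume "z \<in> y ` {..<Suc n}"
    then obtain i where i: "i < Suc n" "z = y i" by auto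
    then have "poly ?R z = 0"
      unfolding poly_prod by (intro prod_zero) (auto intro!: bexI [of _ i])
    with root [of i] i show "poly (poisson_raise b P) z = poly ?R z" by simp
  qed (use dl dR in auto)
qed

text \<open>
  The raised polynomial equals \<open>- b P\<close> at \<open>gap_left x i\<close>, where \<open>S P\<close> vanishes, and \<open>x i P(x i - 1)\<close>
  at \<open>x i\<close>, where \<open>P\<close> vanishes.  Both arguments of \<open>P\<close> lie between the same two consecutive zeros,
  so the two values have opposite signs, one of them possibly being 0.  To the right of
  \<open>gap_left x n\<close> the positive leading coefficient takes the role of the second value.
\<close>

lemma mesh_zeros_raise:
  assumes P: "mesh_zeros n x P" and b: "0 \<le> b"
  shows "\<exists>y. mesh_zeros (Suc n) y (poisson_raise b P) \<and>
    (\<forall>i\<le>n. gap_left x i \<le> y i) \<and> (\<forall>i<n. y i \<le> x i)"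
proof -
  have "\<exists>u. gap_left x i \<le> u \<and> (i < n \<longrightarrow> u \<le> x i) \<and> poly (poisson_raise b P) u = 0"
    if i: "i \<le> n" for i
  proof (cases "i = n")
    case True
    have "P \<noteq> 0" using mesh_zeros_monic [OF P] by auto
    then have "lead_coeff (poisson_raise b P) > 0"
      using degree_lead_coeff_poisson_raise(2) [of P b] mesh_zeros_monic [OF P] by simp
    from poly_pinfty_gt_lc [OF this] obtain k where
      k: "\<forall>u\<ge>k. lead_coeff (poisson_raise b P) \<le> poly (poisson_raise b P) u" by blast
    have "0 \<le> poly (poisson_raise b P) (max k (gap_left x n))"
      using k \<open>lead_coeff (poisson_raise b P) > 0\<close> by (meson less_le_not_le max.cobounded1 order_trans)
    moreover have "poly (poisson_raise b P) (gap_left x n) \<le> 0"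
      using sign_raise_gap_left [OF P _ b, of n] by simp
    ultimately show ?thesis
      using root_of_weak_sign_change [of "gap_left x n" "max k (gap_left x n)" 1] True by auto
  next
    case False
    with i have lt: "i < n" by simp
    have "0 \<le> (-1) ^ (n - i) * poly P (x i - 1)"
    proof (rule sign_in_gap [OF P i])
      show "i > 0 \<Longrightarrow> x (i - 1) \<le> x i - 1"
        using mesh_zerosD(4) [OF P, of "i - 1"] lt by simp
    qed auto
    moreover have "poly P (x i) = 0"
      unfolding mesh_zerosD(2) [OF P] using lt by (intro prod_zero) auto
    ultimately have "0 \<le> (-1) ^ (n - i) * poly (poisson_raise b P) (x i)"
      using mult_nonneg_nonneg [OF mesh_zerosD(3) [OF P lt]]
      by (simp add: poly_poisson_raise mult.left_commute)
    from root_of_weak_sign_change [OF gap_left_le [OF P lt] sign_raise_gap_left [OF P i b] this]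
    show ?thesis by auto
  qed
  then obtain y where "\<And>i. i \<le> n \<Longrightarrow> gap_left x i \<le> y i \<and> (i < n \<longrightarrow> y i \<le> x i) \<and>
      poly (poisson_raise b P) (y i) = 0" by metis
  then show ?thesis using mesh_zeros_raiseI [OF P, of y b] by (intro exI [of _ y]) auto
qed

lemma mesh_zeros_raise_0:
  assumes P: "mesh_zeros n x P"
  shows "mesh_zeros (Suc n) (gap_left x) (poisson_raise 0 P)"
proof (rule mesh_zeros_raiseI [OF P])
  show "poly (poisson_raise 0 P) (gap_left x i) = 0" if "i \<le> n" for i
    using poly_raise_gap_left [OF P that, of 0] by simp
qed (use gap_left_le [OF P] in auto)

lemma coeff_prod_linear:
  "coeff (\<Prod>i<Suc n. [:- y i, 1:]) n = - (\<Sum>i<Suc n. y i :: real)"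
proof (induction n)
  case (Suc n)
  let ?R = "\<Prod>i<Suc n. [:- y i, 1:]"
  have "degree ?R = Suc n" by (subst degree_prod_eq_sum_degree) auto
  moreover have "lead_coeff ?R = 1" unfolding lead_coeff_prod by simp
  ultimately have "coeff ?R (Suc n) = 1" by simp
  moreover have "(\<Prod>i<Suc (Suc n). [:- y i, 1:]) = pCons 0 ?R - smult (y (Suc n)) ?R"
    by (subst prod.lessThan_Suc) (simp add: mult.commute [of _ "[:- y (Suc n), 1:]"])
  ultimately show ?case using Suc by simp
qed simp

text \<open>
  Compare the coefficients below the leading one; the term \<open>- b P\<close> contributes \<open>- b\<close>.
\<close>

lemma sum_zeros_raise:
  assumes P: "mesh_zeros n x P" and y: "mesh_zeros (Suc n) y (poisson_raise b P)"
    and z: "mesh_zeros (Suc n) z (poisson_raise 0 P)"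
  shows "(\<Sum>i<Suc n. y i) = (\<Sum>i<Suc n. z i) + b"
proof -
  have "poisson_raise b P = poisson_raise 0 P - smult b P"
    by (simp add: poisson_raise_def)
  then have "coeff (poisson_raise b P) n = coeff (poisson_raise 0 P) n - b"
    using mesh_zeros_monic [OF P] by simp
  then show ?thesis
    unfolding mesh_zerosD(1) [OF y] mesh_zerosD(1) [OF z] coeff_prod_linear by simp
qed

lemma mesh_zeros_foldr:
  assumes "mesh_zeros n x P" "\<And>c. c \<in> set cs \<Longrightarrow> 0 \<le> c"
  shows "\<exists>y. mesh_zeros (n + length cs) y (foldr poisson_raise cs P)"
  using assms(2)
proof (induction cs)
  case (Cons c cs)
  then obtain y where "mesh_zeros (n + length cs) y (foldr poisson_raise cs P)" by auto
  from mesh_zeros_raise [OF this, of c] Cons.prems show ?case by auto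
qed (use assms(1) in auto)

lemma poisson_raise_foldr:
  "poisson_raise b (foldr poisson_raise cs P) = foldr poisson_raise cs (poisson_raise b P)"
  by (induction cs) (simp_all add: poisson_raise_commute [of b])

text \<open>
  The zeros of \<open>L 0 P\<close> are the left end points \<open>gap_left x\<close>, hence lie below those of \<open>L c P\<close>.  To
  replace all parameters of the list, replace the outermost one, and then move the resulting \<open>L 0\<close> to the
  innermost position by commutativity before using the induction hypothesis.
\<close>

lemma zeros_above_zero_params:
  assumes "mesh_zeros n x P" "\<And>c. c \<in> set cs \<Longrightarrow> 0 \<le> c"
    and "mesh_zeros (n + length cs) y (foldr poisson_raise cs P)"
    and "mesh_zeros (n + length cs) z (foldr poisson_raise (replicate (length cs) 0) P)"
  shows "(\<forall>i<n + length cs. z i \<le> y i) \<and>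
    (\<Sum>i<n + length cs. y i) = (\<Sum>i<n + length cs. z i) + sum_list cs"
  using assms
proof (induction cs arbitrary: n x P y z)
  case Nil
  then have "\<forall>i<n. z i = y i" using mesh_zeros_unique by fastforce
  then show ?case by simp
next
  case (Cons c cs)
  let ?n = "n + length cs"
  let ?Q = "foldr poisson_raise cs P"
  have c: "0 \<le> c" and cs: "\<And>c. c \<in> set cs \<Longrightarrow> 0 \<le> c" using Cons.prems(2) by auto
  obtain x' where x': "mesh_zeros ?n x' ?Q"
    using mesh_zeros_foldr [OF Cons.prems(1) cs] by blast
  have y: "mesh_zeros (Suc ?n) y (poisson_raise c ?Q)" using Cons.prems(3) by simp
  have w: "mesh_zeros (Suc ?n) (gap_left x') (poisson_raise 0 ?Q)"
    by (rule mesh_zeros_raise_0 [OF x'])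
  obtain y' where y': "mesh_zeros (Suc ?n) y' (poisson_raise c ?Q)"
    "\<And>i. i \<le> ?n \<Longrightarrow> gap_left x' i \<le> y' i"
    using mesh_zeros_raise [OF x' c] by blast
  have wy: "gap_left x' i \<le> y i" if "i < Suc ?n" for i
    using y'(2) [of i] mesh_zeros_unique [OF y y'(1) that] that by simp
  have sum1: "(\<Sum>i<Suc ?n. y i) = (\<Sum>i<Suc ?n. gap_left x' i) + c"
    by (rule sum_zeros_raise [OF x' y w])
  have w': "mesh_zeros (Suc n + length cs) (gap_left x') (foldr poisson_raise cs (poisson_raise 0 P))"
    using w by (simp add: poisson_raise_foldr)
  have z': "mesh_zeros (Suc n + length cs) z
      (foldr poisson_raise (replicate (length cs) 0) (poisson_raise 0 P))"
    using Cons.prems(4) by (simp del: foldr_replicate flip: poisson_raise_foldr)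
  have "(\<forall>i<Suc n + length cs. z i \<le> gap_left x' i) \<and>
    (\<Sum>i<Suc n + length cs. gap_left x' i) = (\<Sum>i<Suc n + length cs. z i) + sum_list cs"
    by (rule Cons.IH [OF mesh_zeros_raise_0 [OF Cons.prems(1)] cs w' z'])
  with wy sum1 show ?case by (force intro: order_trans)
qed

definition prepend_naturals :: "nat \<Rightarrow> (nat \<Rightarrow> real) \<Rightarrow> nat \<Rightarrow> real" where
  "prepend_naturals p x i = (if i < p then real i else real p + x (i - p))"

text \<open>
  Each application of \<open>L 0\<close> shifts all zeros by one and adds a zero at the origin.
\<close>

lemma mesh_zeros_zero_params:
  assumes "mesh_zeros n x P"
  shows "mesh_zeros (n + p) (prepend_naturals p x) (foldr poisson_raise (replicate p 0) P)"
proof (induction p)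
  case 0
  then show ?case using assms by (simp add: prepend_naturals_def [abs_def])
next
  case (Suc p)
  have "gap_left (prepend_naturals p x) = prepend_naturals (Suc p) x"
    by (auto simp: fun_eq_iff gap_left_def prepend_naturals_def Suc_diff_Suc of_nat_diff)
  with mesh_zeros_raise_0 [OF Suc] show ?case by simp
qed

section \<open>Riemann sums\<close>

text \<open>
  Left Riemann sums of mesh \<open>h\<close>; the number of nodes is a free parameter so that the upper limit
  may vary with the mesh.
\<close>

lemma riemann_sum_error:
  fixes f :: "real \<Rightarrow> real"
  assumes cont: "continuous_on {0..G} f" and h: "0 < h"
    and unif: "\<And>u v. u \<in> {0..G} \<Longrightarrow> v \<in> {0..G} \<Longrightarrow> \<bar>u - v\<bar> \<le> h \<Longrightarrow> \<bar>f u - f v\<bar> \<le> e"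
    and p: "real p * h \<le> G"
  shows "\<bar>integral {0..real p * h} f - h * (\<Sum>i<p. f (real i * h))\<bar> \<le> e * (real p * h)"
  using p
proof (induction p)
  case (Suc p)
  let ?u = "real p * h" and ?v = "real (Suc p) * h"
  have uv: "0 \<le> ?u" "?u \<le> ?v" "?v \<le> G" "?v - ?u = h"
    using h Suc.prems by (auto simp: algebra_simps)
  have sub: "continuous_on {a..b} f" if "0 \<le> a" "b \<le> G" for a b
    using cont by (rule continuous_on_subset) (use that in auto)
  have "integral {0..?u} f + integral {?u..?v} f = integral {0..?v} f"
    using uv sub [of 0 ?v]
    by (intro Henstock_Kurzweil_Integration.integral_combine integrable_continuous_real) auto
  moreover have "\<bar>integral {?u..?v} f - h * f ?u\<bar> \<le> e * h"
  proof -
    have "norm (integral {?u..?v} (\<lambda>t. f t - f ?u)) \<le> e * (?v - ?u)"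
    proof (rule integral_bound)
      show "continuous_on {?u..?v} (\<lambda>t. f t - f ?u)"
        using uv by (intro continuous_intros sub) auto
      fix t assume "t \<in> {?u..?v}"
      then have t: "?u \<le> t" "t \<le> ?v" by auto
      then have "t \<in> {0..G}" "?u \<in> {0..G}" "\<bar>t - ?u\<bar> \<le> h"
        using uv unfolding atLeastAtMost_iff by linarith+
      then show "norm (f t - f ?u) \<le> e"
        using unif [of t ?u] by simp
    qed (rule uv)
    moreover have "integral {?u..?v} (\<lambda>t. f t - f ?u) = integral {?u..?v} f - h * f ?u"
      using uv
      by (subst Henstock_Kurzweil_Integration.integral_diff)
        (auto intro!: integrable_continuous_real sub simp: uv(4))
    ultimately show ?thesis using uv(4) by simp
  qed
  moreover have "\<bar>integral {0..?u} f - h * (\<Sum>i<p. f (real i * h))\<bar> \<le> e * ?u"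
    using uv by (intro Suc.IH) auto
  ultimately have "\<bar>integral {0..?v} f - h * (\<Sum>i<Suc p. f (real i * h))\<bar> \<le> e * ?u + e * h"
    by (simp add: algebra_simps del: of_nat_Suc)
  then show ?case by (simp add: algebra_simps)
qed simp

lemma riemann_sum_tendsto:
  fixes f :: "real \<Rightarrow> real" and p N :: "nat \<Rightarrow> nat"
  assumes cont: "continuous_on {0..} f"
    and N: "filterlim N at_top sequentially"
    and p: "(\<lambda>k. real (p k) / real (N k)) \<longlonglongrightarrow> c" and c: "0 \<le> c"
  shows "(\<lambda>k. (\<Sum>i<p k. f (real i / real (N k))) / real (N k)) \<longlonglongrightarrow> integral {0..c} f"
proof -
  let ?G = "c + 1"
  have contG: "continuous_on {0..?G} f" using cont by (rule continuous_on_subset) auto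
  have N': "filterlim (\<lambda>k. real (N k)) at_top sequentially"
    using N filterlim_compose filterlim_real_sequentially by blast
  have pG: "\<forall>\<^sub>F k in sequentially. real (p k) / real (N k) < ?G"
    using p by (rule order_tendstoD) simp
  have "continuous_on {0..?G} (\<lambda>u. integral {0..u} f)"
    by (intro indefinite_integral_continuous_1 integrable_continuous_real contG)
  then have "(\<lambda>k. integral {0..real (p k) / real (N k)} f) \<longlonglongrightarrow> integral {0..c} f"
    by (rule continuous_on_tendsto_compose [OF _ p])
      (use c pG in \<open>auto elim: eventually_mono\<close>)
  moreover have "(\<lambda>k. (\<Sum>i<p k. f (real i / real (N k))) / real (N k) -
      integral {0..real (p k) / real (N k)} f) \<longlonglongrightarrow> 0"
  proof (rule tendstoI)
    fix e :: real assume e: "0 < e"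
    define d where "d = e / (2 * ?G)"
    have "d * ?G = e / 2" using c by (simp add: d_def field_simps)
    moreover have "0 < d" using e c by (simp add: d_def)
    ultimately have d: "0 < d" "d * ?G < e" using e by linarith+
    have "uniformly_continuous_on {0..?G} f"
      by (intro compact_uniformly_continuous contG) auto
    then obtain \<delta> where \<delta>: "0 < \<delta>"
      "\<And>u v. u \<in> {0..?G} \<Longrightarrow> v \<in> {0..?G} \<Longrightarrow> dist v u < \<delta> \<Longrightarrow> dist (f v) (f u) < d"
      using d unfolding uniformly_continuous_on_def by metis
    have "\<forall>\<^sub>F k in sequentially. 1 / \<delta> < real (N k)"
      using N' by (simp add: filterlim_at_top_dense)
    with pG show "\<forall>\<^sub>F k in sequentially. dist ((\<Sum>i<p k. f (real i / real (N k))) / real (N k) -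
        integral {0..real (p k) / real (N k)} f) 0 < e"
    proof eventually_elim
      case (elim k)
      let ?h = "1 / real (N k)"
      have "0 < 1 / \<delta>" using \<delta>(1) by simp
      then have Nk: "0 < real (N k)" using elim(2) by linarith
      then have h: "0 < ?h" "?h < \<delta>" using elim(2) \<delta>(1) by (auto simp: field_simps)
      have "\<bar>integral {0..real (p k) * ?h} f - ?h * (\<Sum>i<p k. f (real i * ?h))\<bar> \<le> d * (real (p k) * ?h)"
      proof (rule riemann_sum_error [OF contG h(1)])
        show "\<bar>f u - f v\<bar> \<le> d" if "u \<in> {0..?G}" "v \<in> {0..?G}" "\<bar>u - v\<bar> \<le> ?h" for u v
          using \<delta>(2) [of v u] that h by (auto simp: dist_real_def)
      qed (use elim in simp)
      also have "\<dots> \<le> d * ?G" using elim d by (intro mult_left_mono) auto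
      also have "\<dots> < e" by (rule d)
      finally show ?case by (simp add: dist_real_def abs_minus_commute)
    qed
  qed
  ultimately show ?thesis
    using tendsto_add by fastforce
qed

section \<open>Zeros of Charlier polynomials and their logarithmic potential\<close>

definition charlier_poly :: "real \<Rightarrow> nat \<Rightarrow> real poly" where
  "charlier_poly b m = (poisson_raise b ^^ m) 1"

definition charlier_zeros :: "real \<Rightarrow> nat \<Rightarrow> nat \<Rightarrow> real" where
  "charlier_zeros b m = (SOME x. mesh_zeros m x (charlier_poly b m))"

lemma mesh_zeros_charlier:
  assumes "0 \<le> b"
  shows "mesh_zeros m (charlier_zeros b m) (charlier_poly b m)"
proof -
  have "mesh_zeros 0 (\<lambda>_. 0) 1" by (simp add: mesh_zeros_def)
  from mesh_zeros_foldr [OF this, of "replicate m b"] assms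
  have "\<exists>x. mesh_zeros m x (charlier_poly b m)" by (simp add: charlier_poly_def)
  then show ?thesis unfolding charlier_zeros_def by (rule someI_ex)
qed

text \<open>
  Multiplication by \<open>x\<close> satisfies \<open>x (L b P) = L b (x P) + L b P + b P\<close>, and pushing it through all
  \<open>m\<close> factors gives the three-term recurrence.
\<close>

lemma charlier_recurrence:
  "[:0, 1:] * charlier_poly b m = charlier_poly b (Suc m) + smult (real m + b) (charlier_poly b m)
     + smult (real m * b) (charlier_poly b (m - 1))"
proof (induction m)
  case 0
  show ?case
    by (simp add: charlier_poly_def poly_eq_poly_eq_iff [symmetric] fun_eq_iff poly_poisson_raise)
next
  case (Suc m)
  let ?C = "charlier_poly b"
  have raise: "?C (Suc n) = poisson_raise b (?C n)" for n by (simp add: charlier_poly_def)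
  have "[:0, 1:] * poisson_raise b P =
      poisson_raise b ([:0, 1:] * P) + poisson_raise b P + smult b P" for P
    by (simp add: poly_eq_poly_eq_iff [symmetric] fun_eq_iff poly_poisson_raise algebra_simps)
  then have "[:0, 1:] * ?C (Suc m) = poisson_raise b ([:0, 1:] * ?C m) + ?C (Suc m) + smult b (?C m)"
    by (simp only: raise)
  moreover have "smult (real m * b) (poisson_raise b (?C (m - 1))) = smult (real m * b) (?C m)"
    by (cases m) (simp_all add: raise)
  ultimately show ?case
    unfolding Suc poisson_raise_add poisson_raise_smult
    by (simp add: raise [symmetric] poly_eq_poly_eq_iff [symmetric] fun_eq_iff algebra_simps)
qed

lemma poly_charlier_Suc:
  "poly (charlier_poly b (Suc m)) x = (x - b - real m) * poly (charlier_poly b m) x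
     - real m * b * poly (charlier_poly b (m - 1)) x"
  using arg_cong [OF charlier_recurrence [of b m], of "\<lambda>P. poly P x"]
  by (simp add: algebra_simps)

text \<open>
  To the right of this bound the recurrence makes the values increase with the degree by a factor
  of at least \<open>m\<close>, so they stay positive.
\<close>

lemma charlier_zeros_less:
  assumes b: "0 \<le> b" and j: "j < m"
  shows "charlier_zeros b m j < 2 * b + 2 * real m"
proof (rule ccontr)
  define x where "x = charlier_zeros b m j"
  assume "\<not> charlier_zeros b m j < 2 * b + 2 * real m"
  then have x: "2 * b + 2 * real m \<le> x" by (simp add: x_def)
  let ?p = "\<lambda>i. poly (charlier_poly b i) x"
  have "0 < ?p i \<and> (i < m \<longrightarrow> real m * ?p i \<le> ?p (Suc i))" if "i \<le> m" for i
    using that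
  proof (induction i)
    case 0
    then show ?case using x b by (simp add: poly_charlier_Suc) (simp add: charlier_poly_def)
  next
    case (Suc i)
    then have IH: "0 < ?p i" "real m * ?p i \<le> ?p (Suc i)" and m: "0 < real m" by auto
    have pos: "0 < ?p (Suc i)" using IH m by (meson less_le_trans mult_pos_pos)
    have "real (Suc i) * ?p i \<le> real m * ?p i"
      using IH(1) Suc.prems by (intro mult_right_mono) auto
    then have "real (Suc i) * ?p i \<le> ?p (Suc i)" using IH(2) by linarith
    then have "b * (real (Suc i) * ?p i) \<le> b * ?p (Suc i)" using b by (rule mult_left_mono)
    moreover have "(real m + b) * ?p (Suc i) \<le> (x - b - real (Suc i)) * ?p (Suc i)" if "Suc i < m"
      using x b that pos by (intro mult_right_mono) auto
    ultimately have "Suc i < m \<Longrightarrow> real m * ?p (Suc i) \<le> ?p (Suc (Suc i))"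
      by (subst poly_charlier_Suc) (simp add: algebra_simps)
    with pos show ?case by blast
  qed
  then have "0 < ?p m" by simp
  moreover have "?p m = 0"
    unfolding mesh_zerosD(2) [OF mesh_zeros_charlier [OF b]] x_def using j by (intro prod_zero) auto
  ultimately show False by simp
qed

text \<open>
  The larger root of \<open>R\<^sup>2 - (z + a + s) R + s a = 0\<close>, that is, the attracting fixed point of
  \<open>R \<mapsto> z + a + s - s a / R\<close>.
\<close>

definition ratio_limit :: "real \<Rightarrow> real \<Rightarrow> real \<Rightarrow> real" where
  "ratio_limit z a s = ((z + a + s) + sqrt ((z + a + s)\<^sup>2 - 4 * s * a)) / 2"

lemma ratio_limit_bounds:
  assumes "0 < z" "0 \<le> a" "0 \<le> s"
  shows "z + a \<le> ratio_limit z a s" "s \<le> ratio_limit z a s"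
    and "ratio_limit z a s = z + a + s - s * a / ratio_limit z a s"
proof -
  let ?D = "(z + a + s)\<^sup>2 - 4 * s * a" and ?R = "ratio_limit z a s"
  have D: "?D = (z + a - s)\<^sup>2 + 4 * z * s" by (simp add: power2_eq_square algebra_simps)
  then have D0: "0 \<le> ?D" using assms by simp
  have "\<bar>z + a - s\<bar> \<le> sqrt ?D"
    using D assms by (intro real_le_rsqrt) simp
  then show *: "z + a \<le> ?R" "s \<le> ?R" by (auto simp: ratio_limit_def field_simps)
  have "2 * ?R - (z + a + s) = sqrt ?D"
  proof -
    have "2 * ((A + Q) / 2) - A = Q" for A Q :: real
      by (simp add: field_simps)
    then show ?thesis unfolding ratio_limit_def .
  qed
  then have "(2 * ?R - (z + a + s))\<^sup>2 = ?D"
    using D0 by simp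
  then have "?R * ?R = (z + a + s) * ?R - s * a"
    by (simp add: power2_eq_square algebra_simps)
  moreover have "?R > 0" using * assms by linarith
  ultimately show "?R = z + a + s - s * a / ?R"
    by (simp add: field_simps)
qed

lemma continuous_on_ln_ratio_limit:
  assumes "0 < z" "0 \<le> a"
  shows "continuous_on {0..} (\<lambda>s. ln (ratio_limit z a s))"
proof -
  have "ratio_limit z a s \<noteq> 0" if "0 \<le> s" for s
    using ratio_limit_bounds(1) [OF assms that] assms by linarith
  then show ?thesis
    by (intro continuous_intros) (auto simp: ratio_limit_def intro!: continuous_intros)
qed

text \<open>
  The map \<open>u \<mapsto> z + a + s - s a / u\<close> contracts towards its fixed point with factor at most
  \<open>q = a / (z + a)\<close>, uniformly in \<open>s\<close>.  The fixed point moves by at most \<open>h / (1 - q)\<close> when \<open>s\<close>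
  increases by \<open>h\<close>.  The accumulated error is bounded by the geometric series of these movements.
\<close>

lemma contraction_error:
  fixes z a h :: real
  assumes z: "0 < z" and a: "0 \<le> a" and h: "0 \<le> h"
    and r0: "r 0 = z + a"
    and rS: "\<And>i. r (Suc i) = z + a + real (Suc i) * h - real (Suc i) * h * a / r i"
  defines "q \<equiv> a / (z + a)"
  shows "z + a \<le> r i \<and> \<bar>r i - ratio_limit z a (real i * h)\<bar> \<le> q / (1 - q)\<^sup>2 * h"
proof -
  have za: "0 < z + a" using z a by simp
  have q: "0 \<le> q" "q < 1" using z a za by (auto simp: q_def divide_less_eq)
  \<comment> \<open>the constant \<open>q / (1 - q)\<^sup>2\<close> is the fixed point of this error recursion\<close>
  have q_eq: "q / (1 - q)\<^sup>2 = q * (q / (1 - q)\<^sup>2 + 1 / (1 - q))"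
  proof -
    have "1 / (1 - q) = (1 - q) / (1 - q)\<^sup>2" using q by (simp add: power2_eq_square)
    then have "q / (1 - q)\<^sup>2 + 1 / (1 - q) = 1 / (1 - q)\<^sup>2"
      by (simp flip: add_divide_distrib)
    then show ?thesis by simp
  qed
  \<comment> \<open>difference quotients of the map at points above \<open>max s (z + a)\<close> and \<open>z + a\<close>\<close>
  have factor: "0 \<le> s * a / (R * u) \<and> s * a / (R * u) \<le> q"
    if "0 \<le> s" "s \<le> R" "z + a \<le> R" "z + a \<le> u" for s R u
  proof -
    have pos: "0 < R" "0 < u" using that za by linarith+
    have "s * (a * (z + a)) \<le> R * (a * u)"
      using that a za pos by (intro mult_mono) auto
    then show ?thesis using pos that a za by (simp add: q_def field_simps)
  qed
  let ?R = "\<lambda>i. ratio_limit z a (real i * h)"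
  have nn: "0 \<le> real i * h" for i using h by simp
  note Rb = ratio_limit_bounds [OF z a nn]
  have lip: "\<bar>?R (Suc i) - ?R i\<bar> \<le> h / (1 - q)" for i
  proof -
    let ?s = "real i * h" and ?t = "real (Suc i) * h"
    have t: "?t = ?s + h" by (simp add: algebra_simps)
    have pos: "0 < ?R i" "0 < ?R (Suc i)" using Rb(1) [of i] Rb(1) [of "Suc i"] za by linarith+
    have alg: "(z + a + (s + h) - (s + h) * a / Q) - (z + a + s - s * a / P) =
        h * (1 - a / Q) + (s * a / P - s * a / Q)" for s P Q :: real
      by (simp add: algebra_simps add_divide_distrib)
    define f where "f = ?s * a / (?R i * ?R (Suc i))"
    have f: "0 \<le> f" "f \<le> q"
      using factor [OF nn Rb(2,1,1), of i "Suc i"] by (auto simp: f_def)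
    have "?R (Suc i) - ?R i = h * (1 - a / ?R (Suc i)) + f * (?R (Suc i) - ?R i)"
    proof -
      have "?R (Suc i) - ?R i = (z + a + ?t - ?t * a / ?R (Suc i)) - (z + a + ?s - ?s * a / ?R i)"
        using Rb(3) [of i] Rb(3) [of "Suc i"] by linarith
      also have "\<dots> = h * (1 - a / ?R (Suc i)) + (?s * a / ?R i - ?s * a / ?R (Suc i))"
        by (simp only: t alg)
      also have "?s * a / ?R i - ?s * a / ?R (Suc i) = f * (?R (Suc i) - ?R i)"
        using pos by (simp add: f_def field_simps)
      finally show ?thesis .
    qed
    then have "(1 - f) * (?R (Suc i) - ?R i) = h * (1 - a / ?R (Suc i))"
      by (simp add: algebra_simps)
    moreover have "0 \<le> 1 - a / ?R (Suc i)" "1 - a / ?R (Suc i) \<le> 1"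
      using pos Rb(1) [of "Suc i"] a z by (auto simp: divide_le_eq)
    ultimately have "\<bar>(1 - f) * (?R (Suc i) - ?R i)\<bar> \<le> h"
      using h by (simp add: abs_mult mult_left_le)
    moreover have "(1 - q) * \<bar>?R (Suc i) - ?R i\<bar> \<le> (1 - f) * \<bar>?R (Suc i) - ?R i\<bar>"
      using f by (intro mult_right_mono) auto
    ultimately have "(1 - q) * \<bar>?R (Suc i) - ?R i\<bar> \<le> h"
      using f q by (simp add: abs_mult)
    then show ?thesis using q by (simp add: pos_le_divide_eq mult.commute)
  qed
  show ?thesis
  proof (induction i)
    case 0
    have "ratio_limit z a 0 = z + a" using za by (simp add: ratio_limit_def)
    then show ?case using r0 q h by simp
  next
    case (Suc i)
    then have r: "z + a \<le> r i" and IH: "\<bar>r i - ?R i\<bar> \<le> q / (1 - q)\<^sup>2 * h" by auto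
    let ?t = "real (Suc i) * h"
    have pos: "0 < r i" "0 < ?R (Suc i)" using r Rb(1) [of "Suc i"] za by linarith+
    define f where "f = ?t * a / (?R (Suc i) * r i)"
    have f: "0 \<le> f" "f \<le> q"
      using factor [OF nn Rb(2) Rb(1) r, of "Suc i"] by (auto simp: f_def)
    have "a / r i \<le> 1" using r pos z by (simp add: divide_le_eq)
    then have "?t * (a / r i) \<le> ?t" using nn by (metis mult.right_neutral mult_left_mono)
    then have lower: "z + a \<le> r (Suc i)" unfolding rS by simp
    have "r (Suc i) - ?R (Suc i) = ?t * a / ?R (Suc i) - ?t * a / r i"
      using rS [of i] Rb(3) [of "Suc i"] by linarith
    also have "\<dots> = f * (r i - ?R (Suc i))"
      using pos by (simp add: f_def field_simps)
    finally have "\<bar>r (Suc i) - ?R (Suc i)\<bar> = f * \<bar>r i - ?R (Suc i)\<bar>"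
      using f by (simp add: abs_mult)
    also have "\<dots> \<le> q * (\<bar>r i - ?R i\<bar> + \<bar>?R (Suc i) - ?R i\<bar>)"
      using f by (intro mult_mono) auto
    also have "\<dots> \<le> q * (q / (1 - q)\<^sup>2 * h + h / (1 - q))"
      using IH lip [of i] q by (intro mult_left_mono) auto
    also have "\<dots> = q / (1 - q)\<^sup>2 * h"
      by (subst (2) q_eq) (simp add: algebra_simps)
    finally show ?case using lower by blast
  qed
qed

definition average :: "nat \<Rightarrow> (nat \<Rightarrow> real) \<Rightarrow> (real \<Rightarrow> real) \<Rightarrow> real" where
  "average m x g = (\<Sum>j<m. g (x j)) / real m"

definition scaled_charlier_zeros :: "real \<Rightarrow> nat \<Rightarrow> nat \<Rightarrow> nat \<Rightarrow> real" where
  "scaled_charlier_zeros a N m j = charlier_zeros (real N * a) m j / real N"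

text \<open>
  The product of all \<open>z + zero/N\<close> is, up to sign and scaling, the value of the Charlier polynomial
  at \<open>- N z\<close>.  The recurrence for the degree becomes the iteration of \<open>contraction_error\<close> for the
  ratios of consecutive products, with step \<open>1/N\<close>.
\<close>

lemma log_potential_error:
  assumes z: "0 < z" and a: "0 \<le> a" and N: "0 < N"
  defines "q \<equiv> a / (z + a)"
  shows "\<bar>(\<Sum>j<m. ln (z + scaled_charlier_zeros a N m j)) -
      (\<Sum>i<m. ln (ratio_limit z a (real i / real N)))\<bar> \<le>
    real m * (q / (1 - q)\<^sup>2 / (z + a)) / real N"
proof -
  let ?h = "1 / real N" and ?b = "real N * a"
  have b: "0 \<le> ?b" using a by simp
  have za: "0 < z + a" using z a by simp
  define U where "U m = (\<Prod>j<m. z + scaled_charlier_zeros a N m j)" for m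
  have zeros_nonneg: "0 \<le> scaled_charlier_zeros a N m j" if "j < m" for m j
    using mesh_zerosD(3) [OF mesh_zeros_charlier [OF b] that] N
    by (simp add: scaled_charlier_zeros_def)
  have Upos: "0 < U m" for m
    unfolding U_def using zeros_nonneg z by (intro prod_pos) (auto intro: add_pos_nonneg)
  have U_eq: "U m = (- ?h) ^ m * poly (charlier_poly ?b m) (- real N * z)" for m
  proof -
    have "poly (charlier_poly ?b m) (- real N * z) =
        (\<Prod>j<m. (- real N) * (z + scaled_charlier_zeros a N m j))"
      unfolding mesh_zerosD(2) [OF mesh_zeros_charlier [OF b]]
      using N by (intro prod.cong) (auto simp: scaled_charlier_zeros_def field_simps)
    also have "\<dots> = (- real N) ^ m * U m"
      unfolding prod.distrib U_def by simp
    finally show ?thesis using N by (simp flip: power_mult_distrib mult.assoc)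
  qed
  have U_rec: "U (Suc m) = (z + a + real m * ?h) * U m - real m * ?h * a * U (m - 1)" for m
  proof (cases m)
    case 0
    then show ?thesis unfolding U_eq poly_charlier_Suc using N by (simp add: field_simps)
  next
    case (Suc l)
    define A where "A = poly (charlier_poly ?b (Suc l)) (- real N * z)"
    define B where "B = poly (charlier_poly ?b l) (- real N * z)"
    define y where "y = (- ?h) ^ l"
    have u2: "U (Suc (Suc l)) = (?h * ?h * y) * ((- real N * z - ?b - real (Suc l)) * A - real (Suc l) * ?b * B)"
      unfolding U_eq poly_charlier_Suc [of _ "Suc l"] by (simp add: A_def B_def y_def)
    have u1: "U (Suc l) = - ?h * y * A" and u0: "U l = y * B"
      unfolding U_eq by (simp_all add: A_def B_def y_def)
    show ?thesis unfolding Suc diff_Suc_1 u2 u1 u0 using N by (simp add: field_simps)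
  qed
  define r where "r i = U (Suc i) / U i" for i
  have r0: "r 0 = z + a" using U_rec [of 0] by (simp add: r_def U_def)
  have rS: "r (Suc i) = z + a + real (Suc i) * ?h - real (Suc i) * ?h * a / r i" for i
    using U_rec [of "Suc i"] Upos [of i] Upos [of "Suc i"] unfolding r_def
    by (simp add: field_simps del: of_nat_Suc)
  note err = contraction_error [OF z a _ r0 rS, folded q_def]
  have "(\<Sum>j<m. ln (z + scaled_charlier_zeros a N m j)) = ln (U m)"
    unfolding U_def
  proof (rule ln_prod [symmetric])
    fix j assume "j \<in> {..<m}"
    then have "0 < z + scaled_charlier_zeros a N m j"
      using zeros_nonneg z by (intro add_pos_nonneg) auto
    then show "z + scaled_charlier_zeros a N m j \<noteq> 0" by simp
  qed simp
  also have "ln (U m) = (\<Sum>i<m. ln (r i))"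
  proof (induction m)
    case (Suc m)
    then show ?case using Upos [of m] Upos [of "Suc m"] by (simp add: r_def ln_div)
  qed (simp add: U_def)
  finally have eq: "(\<Sum>j<m. ln (z + scaled_charlier_zeros a N m j)) = (\<Sum>i<m. ln (r i))" .
  have ln_err: "\<bar>ln (r i) - ln (ratio_limit z a (real i / real N))\<bar> \<le> q / (1 - q)\<^sup>2 / (z + a) / real N" for i
  proof -
    let ?R = "ratio_limit z a (real i / real N)"
    have R: "z + a \<le> ?R" using z a by (intro ratio_limit_bounds) auto
    have r: "z + a \<le> r i" "\<bar>r i - ?R\<bar> \<le> q / (1 - q)\<^sup>2 * ?h" using err [of i] N by auto
    have ln_le: "ln u - ln v \<le> \<bar>u - v\<bar> / (z + a)" if "z + a \<le> u" "z + a \<le> v" for u v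
    proof -
      have pos: "0 < u" "0 < v" using that za by linarith+
      have "ln u - ln v = ln (u / v)" using pos by (simp add: ln_div)
      also have "\<dots> \<le> u / v - 1" using pos by (intro ln_le_minus_one) simp
      also have "\<dots> = (u - v) / v" using pos by (simp add: field_simps)
      also have "\<dots> \<le> \<bar>u - v\<bar> / v" using pos by (intro divide_right_mono) auto
      also have "\<dots> \<le> \<bar>u - v\<bar> / (z + a)" using that za pos by (intro divide_left_mono) auto
      finally show ?thesis .
    qed
    have "\<bar>ln (r i) - ln ?R\<bar> \<le> \<bar>r i - ?R\<bar> / (z + a)"
      using ln_le [OF r(1) R] ln_le [OF R r(1)] by (simp add: abs_le_iff abs_minus_commute)
    also have "\<dots> \<le> (q / (1 - q)\<^sup>2 * ?h) / (z + a)"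
      using r(2) za by (intro divide_right_mono) auto
    finally show ?thesis by (simp add: mult_ac)
  qed
  have "\<bar>\<Sum>i<m. ln (r i) - ln (ratio_limit z a (real i / real N))\<bar> \<le>
      (\<Sum>i<m. q / (1 - q)\<^sup>2 / (z + a) / real N)"
    by (rule order_trans [OF sum_abs sum_mono]) (rule ln_err)
  then show ?thesis unfolding eq by (simp add: sum_subtractf)
qed

lemma log_potential_limit:
  fixes m N :: "nat \<Rightarrow> nat"
  assumes z: "0 < z" and a: "0 \<le> a" and c: "0 < c"
    and N: "filterlim N at_top sequentially"
    and m: "(\<lambda>k. real (m k) / real (N k)) \<longlonglongrightarrow> c"
  shows "(\<lambda>k. average (m k) (scaled_charlier_zeros a (N k) (m k)) (\<lambda>u. ln (z + u))) \<longlonglongrightarrow>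
    integral {0..c} (\<lambda>s. ln (ratio_limit z a s)) / c"
proof -
  let ?S = "\<lambda>k. \<Sum>j<m k. ln (z + scaled_charlier_zeros a (N k) (m k) j)"
  let ?T = "\<lambda>k. \<Sum>i<m k. ln (ratio_limit z a (real i / real (N k)))"
  define B where "B = a / (z + a) / (1 - a / (z + a))\<^sup>2 / (z + a)"
  have T: "(\<lambda>k. ?T k / real (N k)) \<longlonglongrightarrow> integral {0..c} (\<lambda>s. ln (ratio_limit z a s))"
    using c by (intro riemann_sum_tendsto [OF continuous_on_ln_ratio_limit [OF z a] N m]) simp
  have N': "filterlim (\<lambda>k. real (N k)) at_top sequentially"
    using N filterlim_compose filterlim_real_sequentially by blast
  have N0: "\<forall>\<^sub>F k in sequentially. 0 < N k"
    using eventually_compose_filterlim [OF eventually_gt_at_top N] .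
  have "(\<lambda>k. real (m k) / real (N k) * B / real (N k)) \<longlonglongrightarrow> 0"
    by (rule tendsto_divide_0 [OF tendsto_mult [OF m tendsto_const] filterlim_at_top_imp_at_infinity [OF N']])
  moreover have "\<forall>\<^sub>F k in sequentially. norm (?S k / real (N k) - ?T k / real (N k)) \<le>
      real (m k) / real (N k) * B / real (N k)"
    using N0
  proof eventually_elim
    case (elim k)
    have "\<bar>?S k - ?T k\<bar> / real (N k) \<le> (real (m k) * B / real (N k)) / real (N k)"
      using log_potential_error [OF z a elim, of "m k"] unfolding B_def
      by (intro divide_right_mono) auto
    then show ?case using elim by (simp add: diff_divide_distrib [symmetric] mult_ac)
  qed
  ultimately have "(\<lambda>k. ?S k / real (N k) - ?T k / real (N k)) \<longlonglongrightarrow> 0"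
    by (rule Lim_null_comparison [rotated])
  from tendsto_add [OF this T] have "(\<lambda>k. ?S k / real (N k)) \<longlonglongrightarrow>
      integral {0..c} (\<lambda>s. ln (ratio_limit z a s))" by simp
  from tendsto_divide [OF this m] c
  have "(\<lambda>k. (?S k / real (N k)) / (real (m k) / real (N k))) \<longlonglongrightarrow>
      integral {0..c} (\<lambda>s. ln (ratio_limit z a s)) / c" by simp
  then show ?thesis
    by (rule Lim_transform_eventually) (use N0 in \<open>auto simp: average_def elim: eventually_mono\<close>)
qed

section \<open>Functionals that vanish on logarithms\<close>

text \<open>
  For both signs \<open>s\<close>, adding \<open>s\<close> times the remainder to \<open>v^(k + 1)\<close> gives a nondecreasing function
  of \<open>v\<close>, because the remainder has derivative \<open>(- v)^k / (1 + v)\<close>.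
\<close>

lemma ln_taylor_bound:
  fixes v :: real
  assumes "0 \<le> v"
  shows "\<bar>ln (1 + v) - (\<Sum>i<k. (-1) ^ i * v ^ Suc i / real (Suc i))\<bar> \<le> v ^ Suc k"
proof -
  define T where "T v = (\<Sum>i<k. (-1) ^ i * v ^ Suc i / real (Suc i))" for v :: real
  have dT: "(T has_real_derivative (1 - (-u) ^ k) / (1 + u)) (at u)" if "0 \<le> u" for u
  proof -
    have "(T has_real_derivative (\<Sum>i<k. (-1) ^ i * (real (Suc i) * u ^ i) / real (Suc i))) (at u)"
      unfolding T_def
      by (auto intro!: derivative_eq_intros simp: mult.commute simp del: of_nat_Suc power_Suc)
    also have "(\<Sum>i<k. (-1) ^ i * (real (Suc i) * u ^ i) / real (Suc i)) = (\<Sum>i<k. (-u) ^ i)"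
      by (intro sum.cong refl, subst power_minus) (simp del: of_nat_Suc)
    also have "\<dots> = (1 - (-u) ^ k) / (1 + u)"
      using geometric_sum [of "-u" k] that by (simp add: field_simps)
    finally show ?thesis .
  qed
  have nonneg_add: "0 \<le> x + y" if "\<bar>x\<bar> \<le> y" for x y :: real using that by linarith
  have mono: "s * (ln (1 + 0) - T 0) + 0 ^ Suc k \<le> s * (ln (1 + v) - T v) + v ^ Suc k"
    if s: "s = 1 \<or> s = -1" for s
  proof (rule DERIV_nonneg_imp_nondecreasing [OF assms])
    fix u :: real assume u: "0 \<le> u" "u \<le> v"
    have "((\<lambda>u. s * (ln (1 + u) - T u) + u ^ Suc k) has_real_derivative
        (s * (1 / (1 + u) - (1 - (-u) ^ k) / (1 + u)) + real (Suc k) * u ^ k)) (at u)"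
    proof (intro DERIV_add DERIV_cmult DERIV_diff dT u(1))
      show "((\<lambda>u. ln (1 + u)) has_real_derivative 1 / (1 + u)) (at u)"
        using u by (auto intro!: derivative_eq_intros)
      show "((\<lambda>u. u ^ Suc k) has_real_derivative real (Suc k) * u ^ k) (at u)"
        using DERIV_pow [of "Suc k" u] by simp
    qed
    moreover have "0 \<le> s * (1 / (1 + u) - (1 - (-u) ^ k) / (1 + u)) + real (Suc k) * u ^ k"
    proof -
      have "\<bar>s * (1 / (1 + u) - (1 - (-u) ^ k) / (1 + u))\<bar> = u ^ k / (1 + u)"
        using s u by (auto simp: diff_divide_distrib [symmetric] power_abs abs_mult)
      also have "\<dots> \<le> u ^ k" using u by (simp add: divide_le_eq mult_le_cancel_left1)
      also have "\<dots> \<le> real (Suc k) * u ^ k" using u by (simp add: algebra_simps)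
      finally show ?thesis
        by (rule nonneg_add)
    qed
    ultimately show "\<exists>y. ((\<lambda>u. s * (ln (1 + u) - T u) + u ^ Suc k) has_real_derivative y) (at u) \<and> 0 \<le> y"
      by blast
  qed
  have "T 0 = 0" by (simp add: T_def)
  with mono [of 1] mono [of "-1"] show ?thesis by (simp add: T_def abs_le_iff)
qed

text \<open>
  In the application \<open>D k\<close> is the difference of two averages over points of \<open>[0, K]\<close> whose logarithmic
  potentials have the same limit.  Working with the difference avoids naming the limits.
\<close>

locale vanishing_functionals =
  fixes D :: "nat \<Rightarrow> (real \<Rightarrow> real) \<Rightarrow> real" and K :: real
  assumes linear: "D k (\<lambda>u. s * g u + t * h u) = s * D k g + t * D k h"
    and bounded: "\<forall>\<^sub>F k in sequentially.
      \<forall>g e. (\<forall>u\<in>{0..K}. \<bar>g u\<bar> \<le> e) \<longrightarrow> \<bar>D k g\<bar> \<le> 2 * e"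
    and const: "(\<lambda>k. D k (\<lambda>u. 1)) \<longlonglongrightarrow> 0"
    and log: "0 < z \<Longrightarrow> (\<lambda>k. D k (\<lambda>u. ln (z + u))) \<longlonglongrightarrow> 0"
    and K: "0 \<le> K"
begin

lemma lin_null:
  assumes "(\<lambda>k. D k g) \<longlonglongrightarrow> 0" "(\<lambda>k. D k h) \<longlonglongrightarrow> 0"
  shows "(\<lambda>k. D k (\<lambda>u. s * g u + t * h u)) \<longlonglongrightarrow> 0"
  using assms unfolding linear by (auto intro!: tendsto_eq_intros)

lemma sum_null:
  fixes n :: nat
  assumes "\<And>i. i < n \<Longrightarrow> (\<lambda>k. D k (g i)) \<longlonglongrightarrow> 0"
  shows "(\<lambda>k. D k (\<lambda>u. \<Sum>i<n. s i * g i u)) \<longlonglongrightarrow> 0"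
  using assms
proof (induction n)
  case 0
  then show ?case using lin_null [OF const const, of 0 0] by simp
next
  case (Suc n)
  then show ?case using lin_null [of "\<lambda>u. \<Sum>i<n. s i * g i u" "g n" 1 "s n"] by simp
qed

lemma uniform_limit_null:
  assumes "\<And>e. 0 < e \<Longrightarrow> \<exists>h. (\<lambda>k. D k h) \<longlonglongrightarrow> 0 \<and> (\<forall>u\<in>{0..K}. \<bar>g u - h u\<bar> \<le> e)"
  shows "(\<lambda>k. D k g) \<longlonglongrightarrow> 0"
proof (rule tendstoI)
  fix e :: real assume e: "0 < e"
  obtain h where h: "(\<lambda>k. D k h) \<longlonglongrightarrow> 0" "\<forall>u\<in>{0..K}. \<bar>g u - h u\<bar> \<le> e / 4"
    using assms [of "e / 4"] e by auto
  have "\<forall>\<^sub>F k in sequentially. dist (D k h) 0 < e / 2"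
    using tendstoD [OF h(1), of "e / 2"] e by simp
  with bounded show "\<forall>\<^sub>F k in sequentially. dist (D k g) 0 < e"
  proof eventually_elim
    case (elim k)
    have "\<bar>D k (\<lambda>u. 1 * g u + (-1) * h u)\<bar> \<le> 2 * (e / 4)"
      using elim(1) h(2) by (intro elim(1) [rule_format]) simp
    then show ?case using elim(2) unfolding linear dist_real_def by linarith
  qed
qed

text \<open>
  The Taylor expansion of \<open>ln (1 + w u)\<close> expresses \<open>u^n\<close> through this logarithm and lower powers, up to
  an error of order \<open>w\<close> after division by \<open>w^n\<close>.  Now let \<open>w\<close> tend to 0 (that is, \<open>z = 1/w\<close> to
  infinity).
\<close>

lemma power_null: "(\<lambda>k. D k (\<lambda>u. u ^ n)) \<longlonglongrightarrow> 0"
proof (induction n rule: less_induct)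
  case (less n)
  show ?case
  proof (cases n)
    case 0
    then show ?thesis using const by simp
  next
    case (Suc l)
    show ?thesis
    proof (rule uniform_limit_null)
      fix e :: real assume e: "0 < e"
      \<comment> \<open>the summand 1 keeps \<open>B\<close> positive when \<open>K = 0\<close>; the choice of \<open>w\<close> makes the remainder at most \<open>e\<close>\<close>
      define B where "B = real n * K ^ Suc n + 1"
      have B: "0 < B" using K by (simp add: B_def add_nonneg_pos)
      define w where "w = e / B"
      have w: "0 < w" "w * (real n * K ^ Suc n) \<le> e"
        using e B by (auto simp: w_def B_def divide_le_eq distrib_left)
      \<comment> \<open>the factor that normalizes the coefficient of \<open>u^n\<close> in the expansion to 1\<close>
      define s where "s = (-1) ^ l * real n / w ^ n"
      have s: "s * ((-1) ^ l * w ^ n / real n) = 1"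
        using w Suc by (simp add: s_def power_mult_distrib [symmetric])
      let ?T = "\<lambda>u. \<Sum>i<l. ((-1) ^ i * w ^ Suc i / real (Suc i)) * u ^ Suc i"
      let ?h = "\<lambda>u. s * (1 * ln (1 / w + u) + ln w * 1) + (- s) * ?T u"
      have "(\<lambda>k. D k ?h) \<longlonglongrightarrow> 0"
        using w Suc by (intro lin_null [of _ ?T] lin_null [of _ "\<lambda>u. 1"] const log sum_null less) auto
      moreover have "\<bar>u ^ n - ?h u\<bar> \<le> e" if u: "u \<in> {0..K}" for u
      proof -
        have "ln (1 / w + u) + ln w = ln (1 + w * u)"
        proof -
          have "0 < 1 / w + u" using w u by (simp add: add_pos_nonneg)
          then have "ln ((1 / w + u) * w) = ln (1 / w + u) + ln w" using w by (intro ln_mult_pos) auto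
          moreover have "(1 / w + u) * w = 1 + w * u" using w by (simp add: field_simps)
          ultimately show ?thesis by simp
        qed
        then have h: "?h u = s * (ln (1 + w * u) - ?T u)" by (simp add: algebra_simps)
        have "(\<Sum>i<n. (-1) ^ i * (w * u) ^ Suc i / real (Suc i)) = ?T u + (-1) ^ l * w ^ n / real n * u ^ n"
          unfolding Suc by (simp add: power_mult_distrib field_simps)
        then have "s * (\<Sum>i<n. (-1) ^ i * (w * u) ^ Suc i / real (Suc i)) =
            s * ?T u + s * ((-1) ^ l * w ^ n / real n) * u ^ n"
          by (simp only: distrib_left mult.assoc)
        then have "s * (\<Sum>i<n. (-1) ^ i * (w * u) ^ Suc i / real (Suc i)) = s * ?T u + u ^ n"
          by (simp only: s mult_1)
        then have "\<bar>u ^ n - ?h u\<bar> =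
            \<bar>s\<bar> * \<bar>ln (1 + w * u) - (\<Sum>i<n. (-1) ^ i * (w * u) ^ Suc i / real (Suc i))\<bar>"
          unfolding h by (simp only: abs_mult [symmetric] right_diff_distrib)
        also have "\<dots> \<le> \<bar>s\<bar> * (w * u) ^ Suc n"
          using w u by (intro mult_left_mono ln_taylor_bound) auto
        also have "\<dots> = w * (real n * u ^ Suc n)"
          using w by (simp add: s_def abs_mult power_abs power_mult_distrib)
        also have "\<dots> \<le> w * (real n * K ^ Suc n)"
          using w u by (intro mult_left_mono power_mono) auto
        finally show ?thesis using w by linarith
      qed
      ultimately show "\<exists>h. (\<lambda>k. D k h) \<longlonglongrightarrow> 0 \<and> (\<forall>u\<in>{0..K}. \<bar>u ^ n - h u\<bar> \<le> e)"
        by blast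
    qed
  qed
qed

lemma continuous_null:
  assumes "continuous_on {0..K} g"
  shows "(\<lambda>k. D k g) \<longlonglongrightarrow> 0"
proof (rule uniform_limit_null)
  fix e :: real assume "0 < e"
  then obtain h where h: "real_polynomial_function h" "\<And>u. u \<in> {0..K} \<Longrightarrow> \<bar>g u - h u\<bar> < e"
    using Stone_Weierstrass_real_polynomial_function [OF compact_Icc assms] by blast
  from h(1) obtain a n where "h = (\<lambda>u. \<Sum>i\<le>n. a i * u ^ i)"
    unfolding real_polynomial_function_iff_sum by blast
  then have "h = (\<lambda>u. \<Sum>i<Suc n. a i * u ^ i)" by (simp add: lessThan_Suc_atMost)
  then have "(\<lambda>k. D k h) \<longlonglongrightarrow> 0" using sum_null [of "Suc n" "\<lambda>i u. u ^ i" a] power_null by (simp only:)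
  with h(2) show "\<exists>h. (\<lambda>k. D k h) \<longlonglongrightarrow> 0 \<and> (\<forall>u\<in>{0..K}. \<bar>g u - h u\<bar> \<le> e)"
    by (meson less_imp_le)
qed

end

section \<open>Limit densities of separated points\<close>

lemma continuous_on_of_Lipschitz_cdf:
  assumes "real_distribution M" and lip: "\<And>u v. u \<le> v \<Longrightarrow> cdf M v - cdf M u \<le> L * (v - u)"
  shows "continuous_on UNIV (cdf M)"
proof -
  interpret real_distribution M by fact
  have "dist (cdf M v) (cdf M u) \<le> L * dist v u" for u v
    using lip [of u v] lip [of v u] cdf_nondecreasing [of u v] cdf_nondecreasing [of v u]
    by (cases "u \<le> v") (auto simp: dist_real_def)
  moreover have "0 \<le> L" using lip [of 0 1] cdf_nondecreasing [of 0 1] by simp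
  ultimately have "L-lipschitz_on UNIV (cdf M)" by (intro lipschitz_onI)
  then show ?thesis by (rule lipschitz_on_continuous_on)
qed

text \<open>
  If \<open>F\<close> is the distribution function, then \<open>G u = L u - F u\<close> is nondecreasing as well.  The two
  interval measures add up to \<open>L\<close> times Lebesgue measure, so each of them is dominated by it.
\<close>

lemma absolutely_continuous_of_Lipschitz_cdf:
  assumes M: "real_distribution M" and L: "0 < L"
    and lip: "\<And>u v. u \<le> v \<Longrightarrow> cdf M v - cdf M u \<le> L * (v - u)"
  shows "absolutely_continuous lborel M"
proof -
  interpret real_distribution M by fact
  have cont: "continuous_on UNIV (cdf M)"
    by (rule continuous_on_of_Lipschitz_cdf [OF M lip])
  define G where "G u = L * u - cdf M u" for u
  define T where "T = interval_measure G"
  have G_mono: "G u \<le> G v" if "u \<le> v" for u v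
    using lip [OF that] by (simp add: G_def algebra_simps)
  have G_cont: "continuous_on UNIV G"
    unfolding G_def by (intro continuous_intros cont)
  have G_right: "continuous (at_right u) G" for u
    using G_cont by (simp add: continuous_on_eq_continuous_at continuous_at_imp_continuous_at_within)
  \<comment> \<open>the sum of both measures, normalized to give each interval its length\<close>
  define S where "S = measure_of UNIV (sets borel)
    (\<lambda>A. ennreal (1 / L) * (emeasure M A + emeasure T A))"
  have sets_S [simp]: "sets S = sets borel"
    using sets.sets_measure_of_eq [of borel] by (simp add: S_def)
  have emeasure_S: "emeasure S A = ennreal (1 / L) * (emeasure M A + emeasure T A)"
    if "A \<in> sets borel" for A
    unfolding S_def
  proof (rule emeasure_measure_of_sigma)
    show "sigma_algebra UNIV (sets (borel :: real measure))"
      using sets.sigma_algebra_axioms [of borel] by simp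
    show "countably_additive (sets borel) (\<lambda>A. ennreal (1 / L) * (emeasure M A + emeasure T A))"
    proof (rule countably_additiveI)
      fix A :: "nat \<Rightarrow> real set"
      assume A: "range A \<subseteq> sets borel" "disjoint_family A"
      have "(\<Sum>i. emeasure M (A i)) = emeasure M (\<Union>i. A i)"
        using A by (intro suminf_emeasure) auto
      moreover have "(\<Sum>i. emeasure T (A i)) = emeasure T (\<Union>i. A i)"
        using A by (intro suminf_emeasure) (auto simp: T_def)
      ultimately show "(\<Sum>i. ennreal (1 / L) * (emeasure M (A i) + emeasure T (A i))) =
          ennreal (1 / L) * (emeasure M (\<Union>i. A i) + emeasure T (\<Union>i. A i))"
        by (simp add: suminf_add [symmetric] ennreal_suminf_cmult)
    qed
  qed (use that in \<open>auto simp: positive_def\<close>)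
  have "lborel = S"
  proof (rule lborel_eqI)
    fix l u :: real assume "\<And>b. b \<in> Basis \<Longrightarrow> l \<bullet> b \<le> u \<bullet> b"
    then have lu: "l \<le> u" by simp
    have diff: "{l<..<u} = {l<..u} - {u}" by auto
    show "emeasure S (box l u) = (\<Prod>b\<in>Basis. (u - l) \<bullet> b)"
    proof (cases "l = u")
      case False
      then have "l < u" using lu by simp
      have "emeasure M {u} = 0"
        using cont isCont_cdf [of u]
        by (simp add: continuous_on_eq_continuous_at emeasure_eq_measure)
      then have "emeasure M {l<..<u} = ennreal (cdf M u - cdf M l)"
        unfolding diff using emeasure_Ioc [OF lu] \<open>l < u\<close> by (subst emeasure_Diff) auto
      moreover have "emeasure T {u} = 0"
        using emeasure_interval_measure_Icc [of u u G] G_mono G_cont by (simp add: T_def)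
      then have "emeasure T {l<..<u} = ennreal (G u - G l)"
        unfolding diff using emeasure_interval_measure_Ioc [OF lu, of G] G_mono G_right \<open>l < u\<close>
        by (subst emeasure_Diff) (auto simp: T_def)
      moreover have "box l u = {l<..<u}" by (simp add: box_real)
      ultimately have "emeasure S (box l u) =
          ennreal (1 / L) * (ennreal (cdf M u - cdf M l) + ennreal (G u - G l))"
        by (simp add: emeasure_S)
      also have "\<dots> = ennreal (1 / L * ((cdf M u - cdf M l) + (G u - G l)))"
        using G_mono [OF lu] cdf_nondecreasing [OF lu] L
        by (simp add: ennreal_plus [symmetric] ennreal_mult [symmetric] del: ennreal_plus)
      also have "1 / L * ((cdf M u - cdf M l) + (G u - G l)) = u - l"
        using L by (simp add: G_def field_simps)
      finally show ?thesis by simp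
    qed (simp add: emeasure_S)
  qed simp
  show ?thesis
    unfolding absolutely_continuous_def
  proof
    fix A assume A: "A \<in> null_sets (lborel :: real measure)"
    then have "emeasure S A = 0" "A \<in> sets borel" using \<open>lborel = S\<close> by auto
    with L have "emeasure M A = 0" by (simp add: emeasure_S)
    with \<open>A \<in> sets borel\<close> show "A \<in> null_sets M" by auto
  qed
qed

lemma density_of_Lipschitz_cdf:
  assumes M: "real_distribution M" and L: "0 < L"
    and lip: "\<And>u v. u \<le> v \<Longrightarrow> cdf M v - cdf M u \<le> L * (v - u)"
  obtains w where "w \<in> borel_measurable borel" "\<And>u. 0 \<le> w u" "M = density lborel (\<lambda>u. ennreal (w u))"
proof -
  interpret real_distribution M by fact
  have "absolutely_continuous lborel M" by (rule absolutely_continuous_of_Lipschitz_cdf [OF M L lip])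
  then obtain f :: "real \<Rightarrow> ennreal" where f: "f \<in> borel_measurable lborel" "density lborel f = M"
    using sigma_finite_measure.Radon_Nikodym [OF sigma_finite_lborel, of M] by auto
  have "(\<integral>\<^sup>+ u. f u \<partial>lborel) = emeasure (density lborel f) UNIV"
    using f(1) by (simp add: emeasure_density)
  also have "\<dots> = 1" using emeasure_space_1 by (simp add: f(2))
  finally have "(\<integral>\<^sup>+ u. f u \<partial>lborel) = 1" .
  then have "AE u in lborel. f u \<noteq> \<infinity>"
    using f(1) by (intro nn_integral_PInf_AE) auto
  then have "AE u in lborel. f u = ennreal (enn2real (f u))"
    by eventually_elim (simp add: ennreal_enn2real_if)
  then have "density lborel f = density lborel (\<lambda>u. ennreal (enn2real (f u)))"
    using f(1) by (intro density_cong) auto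
  then show ?thesis
    using f by (intro that [of "\<lambda>u. enn2real (f u)"]) auto
qed

lemma card_separated_le:
  fixes x :: "nat \<Rightarrow> real"
  assumes gap: "\<And>i j. i \<le> j \<Longrightarrow> j < m \<Longrightarrow> x i + real (j - i) * d \<le> x j"
    and d: "0 < d" and uv: "u \<le> v"
  shows "real (card {j. j < m \<and> u < x j \<and> x j \<le> v}) \<le> (v - u) / d + 1"
proof -
  let ?S = "{j. j < m \<and> u < x j \<and> x j \<le> v}"
  have fin: "finite ?S" by simp
  show ?thesis
  proof (cases "?S = {}")
    case True
    show ?thesis unfolding True using d uv by simp
  next
    case False
    define i where "i = Min ?S"
    define l where "l = Max ?S"
    have i: "i \<in> ?S" unfolding i_def by (rule Min_in [OF fin False])
    have l: "l \<in> ?S" unfolding l_def by (rule Max_in [OF fin False])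
    have sub: "?S \<subseteq> {i..l}"
      unfolding i_def l_def using Min_le [OF fin] Max_ge [OF fin] by (intro subsetI) simp
    have "i \<le> l" using subsetD [OF sub i] by simp
    have "card ?S \<le> card {i..l}" using sub by (intro card_mono) auto
    then have "real (card ?S) \<le> real (l - i) + 1" using \<open>i \<le> l\<close> by simp
    moreover have "real (l - i) * d \<le> v - u"
      using gap [OF \<open>i \<le> l\<close>] i l by auto
    then have "real (l - i) \<le> (v - u) / d" using d by (simp add: le_divide_eq)
    ultimately show ?thesis by linarith
  qed
qed

definition empirical :: "nat \<Rightarrow> (nat \<Rightarrow> real) \<Rightarrow> real measure" where
  "empirical m x = distr (measure_pmf (pmf_of_set {..<m})) borel x"

lemma real_distribution_empirical: "real_distribution (empirical m x)"
  unfolding empirical_def by (rule prob_space.real_distribution_distr) (auto intro: prob_space_measure_pmf)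

lemma measure_empirical:
  assumes "0 < m" "A \<in> sets borel"
  shows "measure (empirical m x) A = real (card {j. j < m \<and> x j \<in> A}) / real m"
proof -
  have "measure (empirical m x) A = measure (measure_pmf (pmf_of_set {..<m})) (x -` A)"
    unfolding empirical_def using assms by (subst measure_distr) auto
  also have "\<dots> = real (card ({..<m} \<inter> x -` A)) / real m"
    using assms by (subst measure_pmf_of_set) auto
  also have "{..<m} \<inter> x -` A = {j. j < m \<and> x j \<in> A}" by auto
  finally show ?thesis .
qed

lemma integral_empirical:
  assumes "0 < m" "g \<in> borel_measurable borel"
  shows "integral\<^sup>L (empirical m x) g = average m x g"
proof -
  have "integral\<^sup>L (empirical m x) g = (\<integral>j. g (x j) \<partial>measure_pmf (pmf_of_set {..<m}))"
    unfolding empirical_def using assms by (intro integral_distr) auto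
  also have "\<dots> = average m x g"
    using assms by (subst integral_pmf_of_set) (auto simp: average_def)
  finally show ?thesis .
qed

text \<open>
  Helly's theorem gives a weak limit along a subsequence.  An interval of length \<open>d\<close> contains at most
  \<open>d N + 1\<close> of the points, and passing to the limit at continuity points of the distribution function
  shows that it is Lipschitz with constant \<open>1/c\<close>.
\<close>

lemma separated_points_have_limit_density:
  fixes x :: "nat \<Rightarrow> nat \<Rightarrow> real" and m N :: "nat \<Rightarrow> nat"
  assumes m0: "\<And>k. 0 < m k" and N0: "\<And>k. 0 < N k" and K: "0 < K"
    and range: "\<And>k j. j < m k \<Longrightarrow> x k j \<in> {0..K}"
    and gap: "\<And>k i j. i \<le> j \<Longrightarrow> j < m k \<Longrightarrow> x k i + real (j - i) * (1 / real (N k)) \<le> x k j"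
    and N: "filterlim N at_top sequentially"
    and c: "0 < c" and m: "(\<lambda>k. real (m k) / real (N k)) \<longlonglongrightarrow> c"
  obtains s :: "nat \<Rightarrow> nat" and w where "strict_mono s" "w \<in> borel_measurable borel" "\<And>u. 0 \<le> w u"
    "set_integrable lborel {0..K} w" "(LBINT u:{0..K}. w u) = 1"
    "\<And>g. continuous_on {0..K} g \<Longrightarrow>
      (\<lambda>k. average (m (s k)) (x (s k)) g) \<longlonglongrightarrow> (LBINT u:{0..K}. w u * g u)"
proof -
  define \<mu> where "\<mu> k = empirical (m k) (x k)" for k
  have dist: "real_distribution (\<mu> k)" for k
    unfolding \<mu>_def by (rule real_distribution_empirical)
  have full: "measure (\<mu> k) A = 1" if "A \<in> sets borel" "{0..K} \<subseteq> A" for A k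
  proof -
    have "{j. j < m k \<and> x k j \<in> A} = {..<m k}" using range that by auto
    then show ?thesis using m0 that(1) by (simp add: \<mu>_def measure_empirical)
  qed
  have "tight \<mu>"
    unfolding tight_def
  proof (intro conjI allI impI)
    fix \<epsilon> :: real assume "0 < \<epsilon>"
    moreover have "measure (\<mu> k) {-1<..K} = 1" for k by (rule full) auto
    ultimately show "\<exists>a b. a < b \<and> (\<forall>n. 1 - \<epsilon> < measure (\<mu> n) {a<..b})"
      using K by (intro exI [of _ "-1"] exI [of _ K]) auto
  qed (rule dist)
  from tight_imp_convergent_subsubsequence [OF this strict_mono_id]
  obtain s M where s: "strict_mono s" and M: "real_distribution M" and conv: "weak_conv_m (\<mu> \<circ> s) M"
    by (auto simp: comp_def)
  interpret M: real_distribution M by fact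
  have cdf_conv: "(\<lambda>k. cdf (\<mu> (s k)) u) \<longlonglongrightarrow> cdf M u" if "isCont (cdf M) u" for u
    using conv that by (simp add: weak_conv_m_def weak_conv_def comp_def)
  have N': "filterlim (\<lambda>k. real (N k)) at_top sequentially"
    using N filterlim_compose filterlim_real_sequentially by blast
  have cdf_bound: "cdf (\<mu> k) v - cdf (\<mu> k) u \<le> (v - u + 1 / real (N k)) / (real (m k) / real (N k))"
    if "u < v" for u v k
  proof -
    interpret real_distribution "\<mu> k" by (rule dist)
    have "cdf (\<mu> k) v - cdf (\<mu> k) u = real (card {j. j < m k \<and> u < x k j \<and> x k j \<le> v}) / real (m k)"
      using cdf_diff_eq [OF that] m0 by (simp add: \<mu>_def measure_empirical)
    also have "\<dots> \<le> ((v - u) / (1 / real (N k)) + 1) / real (m k)"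
      using N0 that by (intro divide_right_mono card_separated_le gap) auto
    also have "\<dots> = (v - u + 1 / real (N k)) / (real (m k) / real (N k))"
      using N0 [of k] m0 [of k] by (simp add: field_simps)
    finally show ?thesis .
  qed
  \<comment> \<open>weak convergence controls the limit only at continuity points, but these are dense\<close>
  have near_cont: "\<exists>t. a < t \<and> t < b \<and> isCont (cdf M) t" if "a < b" for a b :: real
  proof -
    have "countable {t. 0 < measure M {t}}" by (rule M.countable_atoms)
    moreover have "uncountable {a<..<b}" using that by (rule uncountable_open_interval [THEN iffD2])
    ultimately have "\<not> {a<..<b} \<subseteq> {t. 0 < measure M {t}}" using countable_subset by blast
    then obtain t where "t \<in> {a<..<b}" "t \<notin> {t. 0 < measure M {t}}" by blast
    then have "a < t" "t < b" "measure M {t} = 0" by (auto simp: zero_less_measure_iff)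
    then show ?thesis using M.isCont_cdf [of t] by blast
  qed
  have lip_cont: "cdf M v - cdf M u \<le> (v - u) / c"
    if "isCont (cdf M) u" "isCont (cdf M) v" "u < v" for u v
  proof (rule tendsto_le [OF trivial_limit_sequentially])
    show "(\<lambda>k. cdf (\<mu> (s k)) v - cdf (\<mu> (s k)) u) \<longlonglongrightarrow> cdf M v - cdf M u"
      by (intro tendsto_diff cdf_conv that)
    have "(\<lambda>k. 1 / real (N k)) \<longlonglongrightarrow> 0"
      using N' by (intro tendsto_divide_0 [OF tendsto_const] filterlim_at_top_imp_at_infinity)
    then have "(\<lambda>k. (v - u + 1 / real (N k)) / (real (m k) / real (N k))) \<longlonglongrightarrow> (v - u + 0) / c"
      using c by (intro tendsto_intros m) auto
    from LIMSEQ_subseq_LIMSEQ [OF this s]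
    show "(\<lambda>k. (v - u + 1 / real (N (s k))) / (real (m (s k)) / real (N (s k)))) \<longlonglongrightarrow> (v - u) / c"
      by (simp add: comp_def)
    show "\<forall>\<^sub>F k in sequentially. cdf (\<mu> (s k)) v - cdf (\<mu> (s k)) u \<le>
        (v - u + 1 / real (N (s k))) / (real (m (s k)) / real (N (s k)))"
      using cdf_bound [OF that(3)] by simp
  qed
  have lip: "cdf M v - cdf M u \<le> (1 / c) * (v - u)" if "u \<le> v" for u v
  proof (rule field_le_epsilon)
    fix e :: real assume e: "0 < e"
    define d where "d = e * c / 2"
    have d: "0 < d" using e c by (simp add: d_def)
    obtain u' v' where u': "u - d < u'" "u' < u" "isCont (cdf M) u'"
      and v': "v < v'" "v' < v + d" "isCont (cdf M) v'"
      using near_cont [of "u - d" u] near_cont [of v "v + d"] d by auto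
    have "cdf M v - cdf M u \<le> cdf M v' - cdf M u'"
      using M.cdf_nondecreasing [of v v'] M.cdf_nondecreasing [of u' u] u' v' by simp
    also have "\<dots> \<le> (v' - u') / c" using u' v' that by (intro lip_cont) auto
    also have "\<dots> \<le> ((v - u) + 2 * d) / c" using u' v' c by (intro divide_right_mono) auto
    also have "\<dots> = (1 / c) * (v - u) + e" using c by (simp add: d_def field_simps)
    finally show "cdf M v - cdf M u \<le> (1 / c) * (v - u) + e" .
  qed
  have cdf_cont: "isCont (cdf M) u" for u
    using continuous_on_of_Lipschitz_cdf [OF M lip]
    by (simp add: continuous_on_eq_continuous_at)
  have cdf_K: "cdf M K = 1"
  proof (rule LIMSEQ_unique [OF cdf_conv [OF cdf_cont]])
    show "(\<lambda>k. cdf (\<mu> (s k)) K) \<longlonglongrightarrow> 1" unfolding cdf_def by (subst full) auto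
  qed
  have cdf_0: "cdf M 0 = 0"
  proof -
    have neg: "cdf M u = 0" if "u < 0" for u
    proof (rule LIMSEQ_unique [OF cdf_conv [OF cdf_cont]])
      have "cdf (\<mu> k) u = 0" for k
      proof -
        have "{j. j < m k \<and> x k j \<in> {..u}} = {}" using range [of _ k] that by force
        then show ?thesis unfolding cdf_def \<mu>_def by (subst measure_empirical [OF m0]) simp_all
      qed
      then show "(\<lambda>k. cdf (\<mu> (s k)) u) \<longlonglongrightarrow> 0" by simp
    qed
    have "cdf M 0 \<le> 0 + e" if "0 < e" for e
      using lip [of "- (e * c)" 0] neg [of "- (e * c)"] that c by simp
    then have "cdf M 0 \<le> 0" by (rule field_le_epsilon)
    then show ?thesis using M.cdf_nonneg [of 0] by simp
  qed
  have "measure M {0<..K} = 1"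
    using M.cdf_diff_eq [OF K] cdf_K cdf_0 by simp
  then have AE: "AE u in M. u \<in> {0..K}"
    using M.AE_in_set_eq_1 [of "{0<..K}"] by (auto elim: eventually_mono)
  obtain w where w: "w \<in> borel_measurable borel" "\<And>u. 0 \<le> w u" "M = density lborel (\<lambda>u. ennreal (w u))"
    using density_of_Lipschitz_cdf [OF M _ lip] c by auto
  have w_meas [measurable]: "w \<in> borel_measurable borel" by (rule w)
  have dens: "(LBINT u:{0..K}. w u * g u) = integral\<^sup>L M g"
    if g: "g \<in> borel_measurable borel" for g
  proof -
    note g [measurable]
    have "integral\<^sup>L M g = integral\<^sup>L M (\<lambda>u. indicator {0..K} u * g u)"
    proof (rule integral_cong_AE)
      show "AE u in M. g u = indicator {0..K} u * g u"
        using AE by eventually_elim simp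
    qed simp_all
    also have "\<dots> = (LBINT u. w u *\<^sub>R (indicator {0..K} u * g u))"
      unfolding w(3) using w(2) by (intro integral_density) auto
    also have "\<dots> = (LBINT u:{0..K}. w u * g u)"
      by (simp add: set_lebesgue_integral_def mult_ac)
    finally show ?thesis by simp
  qed
  have "integrable M (\<lambda>u. 1 :: real)" by simp
  then have "integrable lborel w"
    unfolding w(3) using w(2) by (subst (asm) integrable_density) auto
  then have "set_integrable lborel {0..K} w"
    unfolding set_integrable_def by (rule integrable_mult_indicator [rotated]) auto
  moreover have "(LBINT u:{0..K}. w u) = 1"
    using dens [of "\<lambda>_. 1"] M.prob_space by simp
  moreover have "(\<lambda>k. average (m (s k)) (x (s k)) g) \<longlonglongrightarrow> (LBINT u:{0..K}. w u * g u)"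
    if g: "continuous_on {0..K} g" for g
  proof -
    define g' where "g' u = g (max 0 (min K u))" for u
    have cont': "continuous_on UNIV g'"
      unfolding g'_def
      by (rule continuous_on_compose2 [OF g]) (use K in \<open>auto intro!: continuous_intros\<close>)
    have meas: "g' \<in> borel_measurable borel"
      using cont' by (rule borel_measurable_continuous_onI)
    have eq: "g' u = g u" if "u \<in> {0..K}" for u using that by (simp add: g'_def)
    have "bounded (g ` {0..K})"
      by (intro compact_imp_bounded compact_continuous_image g) auto
    then obtain B where B: "\<forall>y\<in>g ` {0..K}. norm y \<le> B"
      unfolding bounded_iff by blast
    have "norm (g' u) \<le> B" for u
      unfolding g'_def using K by (intro B [rule_format] imageI) auto
    then have "(\<lambda>k. integral\<^sup>L ((\<mu> \<circ> s) k) g') \<longlonglongrightarrow> integral\<^sup>L M g'"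
      using cont' dist M conv
      by (intro weak_conv_imp_integral_bdd_continuous_conv [where B = B])
        (auto simp: continuous_on_eq_continuous_at o_def)
    moreover have "integral\<^sup>L ((\<mu> \<circ> s) k) g' = average (m (s k)) (x (s k)) g" for k
    proof -
      have "integral\<^sup>L ((\<mu> \<circ> s) k) g' = average (m (s k)) (x (s k)) g'"
        using integral_empirical [OF m0 meas] by (simp add: \<mu>_def)
      also have "\<dots> = average (m (s k)) (x (s k)) g"
        unfolding average_def using range eq by (intro arg_cong2 [where f = "(/)"] sum.cong) auto
      finally show ?thesis .
    qed
    moreover have "integral\<^sup>L M g' = (LBINT u:{0..K}. w u * g u)"
      unfolding dens [OF meas, symmetric] by (intro set_lebesgue_integral_cong) (auto simp: eq)
    ultimately show ?thesis by simp
  qed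
  ultimately show ?thesis using that [OF s w(1,2)] by blast
qed

section \<open>Limit distribution of the rescaled Charlier zeros\<close>

lemma average_linear:
  "average m x (\<lambda>u. s * g u + t * h u) = s * average m x g + t * average m x h"
  by (simp add: average_def sum.distrib sum_distrib_left add_divide_distrib)

lemma abs_average_le:
  assumes "\<And>j. j < m \<Longrightarrow> x j \<in> A" "\<forall>u\<in>A. \<bar>g u\<bar> \<le> e" "0 \<le> e"
  shows "\<bar>average m x g\<bar> \<le> e"
proof (cases "m = 0")
  case False
  have "\<bar>\<Sum>j<m. g (x j)\<bar> \<le> (\<Sum>j<m. e)"
    using assms by (intro order_trans [OF sum_abs sum_mono]) auto
  then show ?thesis using False by (simp add: average_def divide_le_eq mult.commute)
qed (simp add: average_def assms)

lemma scaled_charlier_zeros_range: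
  assumes a: "0 \<le> a" and "0 < N" "j < m" and "real m / real N \<le> c'"
  shows "scaled_charlier_zeros a N m j \<in> {0..2 * a + 2 * c'}"
proof -
  have b: "0 \<le> real N * a" using a by simp
  have N: "0 < real N" using assms by simp
  have "charlier_zeros (real N * a) m j / real N \<le> (2 * (real N * a) + 2 * real m) / real N"
    using charlier_zeros_less [OF b assms(3)] N by (intro divide_right_mono) auto
  also have "\<dots> = 2 * a + 2 * (real m / real N)" using N by (simp add: field_simps)
  finally show ?thesis
    using mesh_zerosD(3) [OF mesh_zeros_charlier [OF b] assms(3)] assms(4)
    by (simp add: scaled_charlier_zeros_def)
qed

lemma scaled_charlier_zeros_gap:
  assumes "0 \<le> a" "0 < N" "i \<le> j" "j < m"
  shows "scaled_charlier_zeros a N m i + real (j - i) * (1 / real N) \<le> scaled_charlier_zeros a N m j"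
proof -
  have "0 \<le> real N * a" using assms by simp
  from mesh_zeros_gap [OF mesh_zeros_charlier [OF this] assms(3,4)]
  have "(charlier_zeros (real N * a) m i + real (j - i)) / real N \<le> charlier_zeros (real N * a) m j / real N"
    by (intro divide_right_mono) auto
  then show ?thesis by (simp add: scaled_charlier_zeros_def add_divide_distrib)
qed

lemma ceiling_ratio_bounds:
  assumes "0 < c" "0 < N"
  shows "c \<le> real (nat \<lceil>c * real N\<rceil>) / real N" "real (nat \<lceil>c * real N\<rceil>) / real N \<le> c + 1 / real N"
proof -
  have N: "0 < real N" using assms by simp
  have "c * real N \<le> real (nat \<lceil>c * real N\<rceil>)" "real (nat \<lceil>c * real N\<rceil>) \<le> c * real N + 1"
    using mult_pos_pos [OF assms(1) N] by linarith+
  then show "c \<le> real (nat \<lceil>c * real N\<rceil>) / real N" "real (nat \<lceil>c * real N\<rceil>) / real N \<le> c + 1 / real N"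
    using N by (simp_all add: le_divide_eq divide_le_eq distrib_right)
qed

text \<open>
  The density comes from one reference sequence (\<open>N\<close> running through all positive integers and
  \<open>m = \<lceil>c N\<rceil>\<close>); any other admissible sequence has the same logarithmic potentials in the limit, hence the
  same limit on continuous functions.
\<close>

lemma charlier_zero_distribution:
  fixes a c :: real
  assumes a: "0 < a" and c: "0 < c"
  obtains K :: real and w where "0 < K" "w \<in> borel_measurable borel" "\<And>u. 0 \<le> w u"
    "set_integrable lborel {0..K} w" "(LBINT u:{0..K}. w u) = 1"
    "\<And>m N. filterlim N at_top sequentially \<Longrightarrow> (\<lambda>k. real (m k) / real (N k)) \<longlonglongrightarrow> c \<Longrightarrow>
      \<forall>\<^sub>F k in sequentially. \<forall>j<m k. scaled_charlier_zeros a (N k) (m k) j \<in> {0..K}"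
    "\<And>m N g. filterlim N at_top sequentially \<Longrightarrow> (\<lambda>k. real (m k) / real (N k)) \<longlonglongrightarrow> c \<Longrightarrow>
      continuous_on {0..K} g \<Longrightarrow>
      (\<lambda>k. average (m k) (scaled_charlier_zeros a (N k) (m k)) g) \<longlonglongrightarrow> (LBINT u:{0..K}. w u * g u)"
proof -
  define K where "K = 2 * a + 2 * (c + 1)"
  have K: "0 < K" using a c by (simp add: K_def)
  define N' where "N' k = Suc k" for k
  define m' where "m' k = nat \<lceil>c * real (N' k)\<rceil>" for k
  have N'_lim: "filterlim N' at_top sequentially"
    unfolding N'_def by (rule filterlim_Suc)
  have b: "c \<le> real (m' k) / real (N' k)" "real (m' k) / real (N' k) \<le> c + 1 / real (N' k)" for k
    unfolding m'_def using c by (intro ceiling_ratio_bounds; simp add: N'_def)+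
  have inv_lim: "(\<lambda>k. 1 / real (N' k)) \<longlonglongrightarrow> 0"
    unfolding N'_def using LIMSEQ_inverse_real_of_nat by (simp only: inverse_eq_divide)
  have m'_lim: "(\<lambda>k. real (m' k) / real (N' k)) \<longlonglongrightarrow> c"
  proof (rule tendsto_sandwich [OF always_eventually always_eventually tendsto_const])
    show "(\<lambda>k. c + 1 / real (N' k)) \<longlonglongrightarrow> c"
      using tendsto_add [OF tendsto_const inv_lim, of c] by simp
  qed (use b in blast)+
  have N'_pos: "0 < N' k" for k by (simp add: N'_def)
  have m'_pos: "0 < m' k" for k
    using b(1) [of k] c by (cases "m' k = 0") auto
  have range': "scaled_charlier_zeros a (N' k) (m' k) j \<in> {0..K}" if "j < m' k" for k j
  proof -
    have "1 / real (N' k) \<le> 1" by (simp add: N'_def)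
    then have "real (m' k) / real (N' k) \<le> c + 1" using b(2) [of k] by linarith
    then show ?thesis
      unfolding K_def using a N'_pos that by (intro scaled_charlier_zeros_range) auto
  qed
  have gap': "scaled_charlier_zeros a (N' k) (m' k) i + real (j - i) * (1 / real (N' k)) \<le>
      scaled_charlier_zeros a (N' k) (m' k) j" if "i \<le> j" "j < m' k" for k i j
    using a N'_pos that by (intro scaled_charlier_zeros_gap) auto
  obtain s w where s: "strict_mono s" and w: "w \<in> borel_measurable borel" "\<And>u. 0 \<le> w u"
    "set_integrable lborel {0..K} w" "(LBINT u:{0..K}. w u) = 1"
    and lim: "\<And>g. continuous_on {0..K} g \<Longrightarrow>
      (\<lambda>k. average (m' (s k)) (scaled_charlier_zeros a (N' (s k)) (m' (s k))) g) \<longlonglongrightarrow>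
        (LBINT u:{0..K}. w u * g u)"
    by (rule separated_points_have_limit_density [where
          x = "\<lambda>k. scaled_charlier_zeros a (N' k) (m' k)" and m = m' and N = N' and K = K and c = c])
      ((rule m'_pos N'_pos K range' gap' N'_lim c m'_lim | assumption)+, rule that, assumption+)
  have s_lim: "filterlim s at_top sequentially" by (rule filterlim_subseq [OF s])
  have ref_N: "filterlim (\<lambda>k. N' (s k)) at_top sequentially"
    by (rule filterlim_compose [OF N'_lim s_lim])
  have ref_m: "(\<lambda>k. real (m' (s k)) / real (N' (s k))) \<longlonglongrightarrow> c"
    by (rule filterlim_compose [OF m'_lim s_lim])
  have in_range: "\<forall>\<^sub>F k in sequentially. \<forall>j<m k. scaled_charlier_zeros a (N k) (m k) j \<in> {0..K}"
    if N: "filterlim N at_top sequentially" and m: "(\<lambda>k. real (m k) / real (N k)) \<longlonglongrightarrow> c" for m N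
  proof -
    have "\<forall>\<^sub>F k in sequentially. real (m k) / real (N k) < c + 1"
      using m by (rule order_tendstoD) simp
    with eventually_compose_filterlim [OF eventually_gt_at_top [of 0] N] show ?thesis
    proof eventually_elim
      case (elim k)
      show ?case
        unfolding K_def using a elim by (intro allI impI scaled_charlier_zeros_range) auto
    qed
  qed
  have "(\<lambda>k. average (m k) (scaled_charlier_zeros a (N k) (m k)) g) \<longlonglongrightarrow> (LBINT u:{0..K}. w u * g u)"
    if N: "filterlim N at_top sequentially" and m: "(\<lambda>k. real (m k) / real (N k)) \<longlonglongrightarrow> c"
      and g: "continuous_on {0..K} g" for m N g
  proof -
    define D where "D k h = average (m k) (scaled_charlier_zeros a (N k) (m k)) h -
      average (m' (s k)) (scaled_charlier_zeros a (N' (s k)) (m' (s k))) h" for k h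
    interpret vanishing_functionals D K
    proof
      show "D k (\<lambda>u. \<sigma> * g u + \<tau> * h u) = \<sigma> * D k g + \<tau> * D k h" for k \<sigma> g \<tau> h
        by (simp add: D_def average_linear algebra_simps)
      show "\<forall>\<^sub>F k in sequentially. \<forall>g e. (\<forall>u\<in>{0..K}. \<bar>g u\<bar> \<le> e) \<longrightarrow> \<bar>D k g\<bar> \<le> 2 * e"
        using in_range [OF N m]
      proof eventually_elim
        case (elim k)
        show ?case
        proof (intro allI impI)
          fix g :: "real \<Rightarrow> real" and e :: real
          assume e: "\<forall>u\<in>{0..K}. \<bar>g u\<bar> \<le> e"
          then have "\<bar>g 0\<bar> \<le> e" using K by auto
          then have "0 \<le> e" by linarith
          then have "\<bar>average (m k) (scaled_charlier_zeros a (N k) (m k)) g\<bar> \<le> e"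
            "\<bar>average (m' (s k)) (scaled_charlier_zeros a (N' (s k)) (m' (s k))) g\<bar> \<le> e"
            using elim range' e by (auto intro!: abs_average_le [where A = "{0..K}"])
          then show "\<bar>D k g\<bar> \<le> 2 * e" unfolding D_def by linarith
        qed
      qed
      have "\<forall>\<^sub>F k in sequentially. 0 < real (m k) / real (N k)"
        using m c by (rule order_tendstoD)
      then have "\<forall>\<^sub>F k in sequentially. D k (\<lambda>u. 1) = 0"
      proof eventually_elim
        case (elim k)
        then have "0 < m k" by (cases "m k = 0") auto
        then show ?case using m'_pos [of "s k"] by (simp add: D_def average_def)
      qed
      then show "(\<lambda>k. D k (\<lambda>u. 1)) \<longlonglongrightarrow> 0" by (rule tendsto_eventually)
      show "(\<lambda>k. D k (\<lambda>u. ln (z + u))) \<longlonglongrightarrow> 0" if "0 < z" for z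
        using tendsto_diff [OF log_potential_limit [OF that less_imp_le [OF a] c N m]
            log_potential_limit [OF that less_imp_le [OF a] c ref_N ref_m]]
        by (simp add: D_def)
    qed (use K in simp)
    from tendsto_add [OF continuous_null [OF g] lim [OF g]] show ?thesis by (simp add: D_def)
  qed
  then show ?thesis using that [OF K w in_range] by blast
qed

section \<open>From Charlier to multiple Charlier polynomials\<close>

text \<open>
  The raising operators of the first \<open>r - 1\<close> parameters act on the Charlier polynomial of the last one,
  so that \<open>zeros_above_zero_params\<close> applies with \<open>x\<close> the zeros of the latter.
\<close>

lemma multiple_charlier_zeros:
  fixes r :: nat and m :: "nat \<Rightarrow> nat"
  assumes r: "1 \<le> r" and inj: "inj_on b {1..r}" and pos: "\<And>j. j \<in> {1..r} \<Longrightarrow> 0 < b j"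
  defines "p \<equiv> \<Sum>j=1..<r. m j"
  defines "z \<equiv> prepend_naturals p (charlier_zeros (b r) (m r))"
  obtains y where "mesh_zeros (m r + p) y (multiple_charlier r b m)"
    "\<And>i. i < m r + p \<Longrightarrow> z i \<le> y i"
    "(\<Sum>i<m r + p. y i - z i) = (\<Sum>j=1..<r. real (m j) * b j)"
proof -
  define cs where "cs = concat (map (\<lambda>j. replicate (m j) (b j)) [1..<r])"
  have len: "length cs = p"
    by (simp add: cs_def p_def length_concat comp_def sum_list_distinct_conv_sum_set)
  have sum: "sum_list cs = (\<Sum>j=1..<r. real (m j) * b j)"
  proof -
    have "sum_list (concat (map (\<lambda>j. replicate (m j) (b j)) xs)) = (\<Sum>j\<leftarrow>xs. real (m j) * b j)"
      for xs by (induction xs) (simp_all add: sum_list_replicate)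
    then show ?thesis by (simp add: cs_def sum_list_distinct_conv_sum_set)
  qed
  have nonneg: "0 \<le> c" if "c \<in> set cs" for c
    using that pos by (auto simp: cs_def intro: less_imp_le)
  have b: "0 \<le> b r" using pos [of r] r by simp
  have P: "mesh_zeros (m r) (charlier_zeros (b r) (m r)) (charlier_poly (b r) (m r))"
    by (rule mesh_zeros_charlier [OF b])
  have "charlier_params r b m = cs @ replicate (m r) (b r)"
    using r by (simp add: charlier_params_def cs_def)
  then have C: "multiple_charlier r b m = foldr poisson_raise cs (charlier_poly (b r) (m r))"
    using multiple_charlier_eq [OF inj pos] by (simp add: charlier_poly_def)
  obtain y where y: "mesh_zeros (m r + p) y (multiple_charlier r b m)"
    using mesh_zeros_foldr [OF P, of cs] nonneg unfolding C len by blast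
  have z: "mesh_zeros (m r + p) z (foldr poisson_raise (replicate p 0) (charlier_poly (b r) (m r)))"
    unfolding z_def by (rule mesh_zeros_zero_params [OF P])
  from zeros_above_zero_params [OF P, of cs y z] nonneg y z
  have "\<forall>i<m r + p. z i \<le> y i" "(\<Sum>i<m r + p. y i) = (\<Sum>i<m r + p. z i) + sum_list cs"
    unfolding C len by auto
  then show ?thesis using y sum by (intro that [of y]) (auto simp: sum_subtractf)
qed

lemma zero_average_eq:
  assumes "mesh_zeros (mi_size r (floor_index q n)) y
    (multiple_charlier r (scaled_params r a N) (floor_index q n))"
  shows "zero_average r a q n N f = average (mi_size r (floor_index q n)) (\<lambda>i. y i / real N) f"
proof -
  let ?S = "mi_size r (floor_index q n)"
  have "(\<Sum>j=1..?S. f (charlier_zero r (scaled_params r a N) (floor_index q n) j / real N)) =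
      (\<Sum>i<?S. f (y i / real N))"
    unfolding One_nat_def sum.atLeast1_atMost_eq
    by (intro sum.cong) (auto simp: charlier_zero_def mesh_zeros_enum [OF assms])
  then show ?thesis by (simp add: zero_average_def average_def Let_def)
qed

text \<open>
  Uniform continuity on a compact interval handles nearby arguments.  For arguments at distance at
  least \<open>d\<close> the trivial bound \<open>2 B\<close> is at most \<open>2 B / d\<close> times the distance, so \<open>v\<close> may be arbitrarily
  large; this matters because only the mean displacement of the zeros is under control.
\<close>

lemma continuous_bounded_modulus:
  fixes f :: "real \<Rightarrow> real"
  assumes cont: "continuous_on {0..} f" and B: "\<And>u. 0 \<le> u \<Longrightarrow> \<bar>f u\<bar> \<le> B" and e: "0 < e"
  shows "\<exists>C\<ge>0. \<forall>u\<in>{0..G}. \<forall>v\<ge>0. \<bar>f u - f v\<bar> \<le> e + C * \<bar>u - v\<bar>"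
proof -
  have "continuous_on {0..G + 1} f" using cont by (rule continuous_on_subset) auto
  then have "uniformly_continuous_on {0..G + 1} f"
    by (intro compact_uniformly_continuous) auto
  then obtain \<delta> where \<delta>: "0 < \<delta>"
    "\<And>u v. u \<in> {0..G + 1} \<Longrightarrow> v \<in> {0..G + 1} \<Longrightarrow> dist v u < \<delta> \<Longrightarrow> dist (f v) (f u) < e"
    using e unfolding uniformly_continuous_on_def by metis
  define d where "d = min \<delta> 1"
  have d: "0 < d" using \<delta>(1) by (simp add: d_def)
  have B0: "0 \<le> B" using B [of 0] by simp
  show ?thesis
  proof (intro exI conjI ballI allI impI)
    show "0 \<le> 2 * B / d" using B0 d by simp
    fix u v assume u: "u \<in> {0..G}" and v: "(0::real) \<le> v"
    show "\<bar>f u - f v\<bar> \<le> e + 2 * B / d * \<bar>u - v\<bar>"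
    proof (cases "\<bar>u - v\<bar> < d")
      case True
      then have "\<bar>f u - f v\<bar> < e"
        using \<delta>(2) [of v u] u v by (auto simp: d_def dist_real_def)
      moreover have "0 \<le> 2 * B / d * \<bar>u - v\<bar>" using B0 d by simp
      ultimately show ?thesis by linarith
    next
      case False
      have "\<bar>f u - f v\<bar> \<le> 2 * B" using B [of u] B [OF v] u by simp
      also have "\<dots> = 2 * B / d * d" using d by simp
      also have "\<dots> \<le> 2 * B / d * \<bar>u - v\<bar>"
        using False B0 d by (intro mult_left_mono) auto
      finally show ?thesis using e by linarith
    qed
  qed
qed

lemma average_perturbation:
  fixes f :: "real \<Rightarrow> real" and m :: "nat \<Rightarrow> nat"
  assumes cont: "continuous_on {0..} f" and B: "\<And>u. 0 \<le> u \<Longrightarrow> \<bar>f u\<bar> \<le> B"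
    and range: "\<forall>\<^sub>F k in sequentially. \<forall>j<m k. x k j \<in> {0..G} \<and> 0 \<le> y k j"
    and close: "(\<lambda>k. (\<Sum>j<m k. \<bar>x k j - y k j\<bar>) / real (m k)) \<longlonglongrightarrow> 0"
  shows "(\<lambda>k. average (m k) (x k) f - average (m k) (y k) f) \<longlonglongrightarrow> 0"
proof (rule tendstoI)
  fix e :: real assume e: "0 < e"
  obtain C where C: "0 \<le> C" "\<And>u v. u \<in> {0..G} \<Longrightarrow> 0 \<le> v \<Longrightarrow> \<bar>f u - f v\<bar> \<le> e / 2 + C * \<bar>u - v\<bar>"
    using continuous_bounded_modulus [OF cont B, of "e / 2" G] e by auto
  have "(\<lambda>k. C * ((\<Sum>j<m k. \<bar>x k j - y k j\<bar>) / real (m k))) \<longlonglongrightarrow> C * 0"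
    by (intro tendsto_intros close)
  then have "\<forall>\<^sub>F k in sequentially. C * ((\<Sum>j<m k. \<bar>x k j - y k j\<bar>) / real (m k)) < e / 2"
    by (rule order_tendstoD) (use e in simp)
  with range show "\<forall>\<^sub>F k in sequentially. dist (average (m k) (x k) f - average (m k) (y k) f) 0 < e"
  proof eventually_elim
    case (elim k)
    show ?case
    proof (cases "m k = 0")
      case False
      have "\<bar>\<Sum>j<m k. f (x k j) - f (y k j)\<bar> \<le> (\<Sum>j<m k. e / 2 + C * \<bar>x k j - y k j\<bar>)"
        using elim(1) C(2) by (intro order_trans [OF sum_abs sum_mono]) auto
      also have "\<dots> = real (m k) * (e / 2) + C * (\<Sum>j<m k. \<bar>x k j - y k j\<bar>)"
        by (simp add: sum.distrib sum_distrib_left)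
      finally have "\<bar>\<Sum>j<m k. f (x k j) - f (y k j)\<bar> / real (m k) \<le>
          (real (m k) * (e / 2) + C * (\<Sum>j<m k. \<bar>x k j - y k j\<bar>)) / real (m k)"
        by (intro divide_right_mono) auto
      also have "\<dots> = e / 2 + C * ((\<Sum>j<m k. \<bar>x k j - y k j\<bar>) / real (m k))"
        using False by (simp add: add_divide_distrib)
      also have "\<dots> < e" using elim(2) by linarith
      finally show ?thesis
        by (simp add: average_def sum_subtractf diff_divide_distrib [symmetric])
    qed (use e in \<open>simp add: average_def\<close>)
  qed
qed

lemma average_prepend:
  "average (m + p) (\<lambda>i. prepend_naturals p x i / N) f =
     (\<Sum>i<p. f (real i / N)) / real (m + p) +
     real m / real (m + p) * average m (\<lambda>j. real p / N + x j / N) f"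
proof -
  have "{..<m + p} = {..<p} \<union> {p..<p + m}" by auto
  then have "(\<Sum>i<m + p. f (prepend_naturals p x i / N)) =
      (\<Sum>i<p. f (prepend_naturals p x i / N)) + (\<Sum>i=p..<p + m. f (prepend_naturals p x i / N))"
    by (simp add: sum.union_disjoint ivl_disj_int)
  also have "(\<Sum>i=p..<p + m. f (prepend_naturals p x i / N)) =
      (\<Sum>j<m. f (prepend_naturals p x (j + p) / N))"
    using sum.shift_bounds_nat_ivl [of "\<lambda>i. f (prepend_naturals p x i / N)" 0 p m]
    by (simp add: atLeast0LessThan add.commute)
  finally have "(\<Sum>i<m + p. f (prepend_naturals p x i / N)) =
      (\<Sum>i<p. f (real i / N)) + (\<Sum>j<m. f (real p / N + x j / N))"
    by (simp add: prepend_naturals_def add_divide_distrib)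
  then show ?thesis by (cases "m = 0") (simp_all add: average_def add_divide_distrib)
qed

lemma floor_ratio_tendsto:
  fixes n :: "nat \<Rightarrow> nat"
  assumes "0 < q" and n: "filterlim n at_top sequentially"
  shows "(\<lambda>k. real (nat \<lfloor>q * real (n k)\<rfloor>) / real (n k)) \<longlonglongrightarrow> q"
proof (rule tendsto_sandwich)
  have n': "filterlim (\<lambda>k. real (n k)) at_top sequentially"
    using n filterlim_compose filterlim_real_sequentially by blast
  have "(\<lambda>k. 1 / real (n k)) \<longlonglongrightarrow> 0"
    using n' by (intro tendsto_divide_0 [OF tendsto_const] filterlim_at_top_imp_at_infinity)
  from tendsto_diff [OF tendsto_const this, of q]
  show "(\<lambda>k. q - 1 / real (n k)) \<longlonglongrightarrow> q" by simp
  have pos: "\<forall>\<^sub>F k in sequentially. 0 < n k"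
    using eventually_compose_filterlim [OF eventually_gt_at_top n] .
  have bounds: "q * real j - 1 \<le> real (nat \<lfloor>q * real j\<rfloor>)" "real (nat \<lfloor>q * real j\<rfloor>) \<le> q * real j" for j
  proof -
    have "0 \<le> q * real j" using assms by simp
    then show "q * real j - 1 \<le> real (nat \<lfloor>q * real j\<rfloor>)" "real (nat \<lfloor>q * real j\<rfloor>) \<le> q * real j"
      by linarith+
  qed
  show "\<forall>\<^sub>F k in sequentially. q - 1 / real (n k) \<le> real (nat \<lfloor>q * real (n k)\<rfloor>) / real (n k)"
    using pos
  proof eventually_elim
    case (elim k)
    have "(q * real (n k) - 1) / real (n k) \<le> real (nat \<lfloor>q * real (n k)\<rfloor>) / real (n k)"
      by (intro divide_right_mono bounds) simp
    with elim show ?case by (simp add: diff_divide_distrib)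
  qed
  show "\<forall>\<^sub>F k in sequentially. real (nat \<lfloor>q * real (n k)\<rfloor>) / real (n k) \<le> q"
    using pos
  proof eventually_elim
    case (elim k)
    then show ?case using bounds(2) [of "n k"] by (simp add: divide_le_eq)
  qed
qed simp

lemma prob_density_on_shift:
  assumes "\<And>u. 0 \<le> w u" "set_integrable lborel {0..K} w" "(LBINT u:{0..K}. w u) = 1"
  shows "prob_density_on c (c + K) (\<lambda>x. w (x - c))"
    and "(LBINT x:{c..c + K}. w (x - c) * f x) = (LBINT u:{0..K}. w u * f (c + u))"
proof -
  have ind: "indicator {c..c + K} (c + 1 * u) = (indicator {0..K} u :: real)" for u
    by (auto simp: indicator_def)
  have shift: "(LBINT x:{c..c + K}. g x) = (LBINT u:{0..K}. g (c + u))" for g :: "real \<Rightarrow> real"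
    unfolding set_lebesgue_integral_def
    by (subst lborel_integral_real_affine [of 1 _ c]) (simp_all add: ind [simplified])
  have "set_integrable lborel {c..c + K} (\<lambda>x. w (x - c))"
    using assms(2) lborel_integrable_real_affine_iff [of 1 "\<lambda>x. indicator {c..c + K} x *\<^sub>R w (x - c)" c]
    by (simp add: set_integrable_def ind [simplified])
  then show "prob_density_on c (c + K) (\<lambda>x. w (x - c))"
    using assms by (simp add: prob_density_on_def shift)
  show "(LBINT x:{c..c + K}. w (x - c) * f x) = (LBINT u:{0..K}. w u * f (c + u))"
    by (simp add: shift)
qed

theorem theorem5p2:
  fixes r :: nat and a q :: "nat \<Rightarrow> real"
  assumes "\<And>j. j \<in> {1..r} \<Longrightarrow> 0 < a j"
    and "inj_on a {1..<r}"
    and "\<And>j. j \<in> {1..r} \<Longrightarrow> 0 < q j \<and> q j < 1"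
    and "(\<Sum>j=1..r. q j) = 1"
  shows "\<forall>t>0. \<exists>\<alpha> \<beta> v. \<alpha> < \<beta> \<and> (1 - q r) * t \<le> \<alpha> \<and> prob_density_on \<alpha> \<beta> v \<and>
    (\<forall>f :: real \<Rightarrow> real. continuous_on {0..} f \<and> bounded (f ` {0..}) \<longrightarrow>
      (\<forall>n N :: nat \<Rightarrow> nat.
         filterlim n at_top sequentially \<and> filterlim N at_top sequentially \<and>
         (\<lambda>k. real (n k) / real (N k)) \<longlonglongrightarrow> t \<longrightarrow>
         (\<lambda>k. zero_average r a q (n k) (N k) f) \<longlonglongrightarrow>
           1 / t * (LBINT x:{0..(1 - q r) * t}. f x) + q r * (LBINT x:{\<alpha>..\<beta>}. v x * f x)))"
proof (intro allI impI)
  fix t :: real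
  assume t: "t > 0"
  have r: "1 \<le> r" using assms(4) by (cases r) auto
  then have rr: "r \<in> {1..r}" by simp
  have q: "0 < q r" "q r < 1" and ar: "0 < a r" using assms(1,3) [OF rr] by auto
  have interval: "{1..r} = insert r {1..<r}" using r by auto
  have sum_q: "(\<Sum>j=1..<r. q j) = 1 - q r"
    using assms(4) unfolding interval by (subst (asm) sum.insert) auto
  define \<gamma> where "\<gamma> = (1 - q r) * t"
  define c where "c = q r * t"
  have \<gamma>: "0 < \<gamma>" and c: "0 < c" using q t by (auto simp: \<gamma>_def c_def)
  obtain K w where K: "0 < K" and w: "\<And>u. 0 \<le> w u" "set_integrable lborel {0..K} w"
      "(LBINT u:{0..K}. w u) = 1"
    and in_range: "\<And>m N. filterlim N at_top sequentially \<Longrightarrow> (\<lambda>k. real (m k) / real (N k)) \<longlonglongrightarrow> c \<Longrightarrow>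
      \<forall>\<^sub>F k in sequentially. \<forall>j<m k. scaled_charlier_zeros (a r) (N k) (m k) j \<in> {0..K}"
    and lim: "\<And>m N g. filterlim N at_top sequentially \<Longrightarrow> (\<lambda>k. real (m k) / real (N k)) \<longlonglongrightarrow> c \<Longrightarrow>
      continuous_on {0..K} g \<Longrightarrow>
      (\<lambda>k. average (m k) (scaled_charlier_zeros (a r) (N k) (m k)) g) \<longlonglongrightarrow> (LBINT u:{0..K}. w u * g u)"
    by (rule charlier_zero_distribution [OF ar c]) (rule that, assumption+)
  have "(\<lambda>k. zero_average r a q (n k) (N k) f) \<longlonglongrightarrow>
      1 / t * (LBINT x:{0..\<gamma>}. f x) + q r * (LBINT x:{\<gamma>..\<gamma> + K}. w (x - \<gamma>) * f x)"
    if f: "continuous_on {0..} f" "bounded (f ` {0..})"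
      and n: "filterlim n at_top sequentially" and N: "filterlim N at_top sequentially"
      and nN: "(\<lambda>k. real (n k) / real (N k)) \<longlonglongrightarrow> t"
    for f :: "real \<Rightarrow> real" and n N :: "nat \<Rightarrow> nat"
  proof -
    obtain B where "\<forall>y\<in>f ` {0..}. norm y \<le> B" using f(2) unfolding bounded_iff by blast
    then have B: "\<bar>f u\<bar> \<le> B" if "0 \<le> u" for u using that by auto
    define L where "L k = floor_index q (n k)" for k
    define M where "M k = L k r" for k
    define P where "P k = (\<Sum>j=1..<r. L k j)" for k
    define S where "S k = M k + P k" for k
    have size: "mi_size r (L k) = S k" for k
      unfolding mi_size_def interval S_def M_def P_def by (subst sum.insert) auto
    have n_pos: "\<forall>\<^sub>F k in sequentially. 0 < n k" and N_pos: "\<forall>\<^sub>F k in sequentially. 0 < N k"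
      using eventually_compose_filterlim [OF eventually_gt_at_top n]
        eventually_compose_filterlim [OF eventually_gt_at_top N] by auto
    have N': "filterlim (\<lambda>k. real (N k)) at_top sequentially"
      using N filterlim_compose filterlim_real_sequentially by blast
    have L_lim: "(\<lambda>k. real (L k j) / real (n k)) \<longlonglongrightarrow> q j" if "j \<in> {1..r}" for j
      unfolding L_def floor_index_def using assms(3) [OF that] n by (intro floor_ratio_tendsto) auto
    have M_lim: "(\<lambda>k. real (M k) / real (n k)) \<longlonglongrightarrow> q r"
      unfolding M_def by (rule L_lim [OF rr])
    have P_lim: "(\<lambda>k. real (P k) / real (n k)) \<longlonglongrightarrow> 1 - q r"
      unfolding P_def of_nat_sum sum_divide_distrib sum_q [symmetric]
      by (intro tendsto_sum L_lim) auto
    have S_lim: "(\<lambda>k. real (S k) / real (n k)) \<longlonglongrightarrow> 1"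
      using tendsto_add [OF M_lim P_lim] by (simp add: S_def add_divide_distrib)
    have over_N: "(\<lambda>k. real (X k) / real (N k)) \<longlonglongrightarrow> x * t"
      if "(\<lambda>k. real (X k) / real (n k)) \<longlonglongrightarrow> x" for X x
    proof (rule Lim_transform_eventually [OF tendsto_mult [OF that nN]])
      show "\<forall>\<^sub>F k in sequentially. real (X k) / real (n k) * (real (n k) / real (N k)) =
          real (X k) / real (N k)"
        using n_pos by eventually_elim simp
    qed
    have over_S: "(\<lambda>k. real (X k) / real (S k)) \<longlonglongrightarrow> x"
      if "(\<lambda>k. real (X k) / real (n k)) \<longlonglongrightarrow> x" for X x
    proof (rule Lim_transform_eventually)
      show "(\<lambda>k. (real (X k) / real (n k)) / (real (S k) / real (n k))) \<longlonglongrightarrow> x"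
        using tendsto_divide [OF that S_lim] by simp
      show "\<forall>\<^sub>F k in sequentially. (real (X k) / real (n k)) / (real (S k) / real (n k)) =
          real (X k) / real (S k)"
        using n_pos by eventually_elim simp
    qed
    have MN: "(\<lambda>k. real (M k) / real (N k)) \<longlonglongrightarrow> c" unfolding c_def by (rule over_N [OF M_lim])
    have PN: "(\<lambda>k. real (P k) / real (N k)) \<longlonglongrightarrow> \<gamma>" unfolding \<gamma>_def by (rule over_N [OF P_lim])
    have SN: "(\<lambda>k. real (S k) / real (N k)) \<longlonglongrightarrow> t" using over_N [OF S_lim] by simp
    have PN_less: "\<forall>\<^sub>F k in sequentially. real (P k) / real (N k) < \<gamma> + 1"
      using PN by (rule order_tendstoD) simp
    define x where "x k = scaled_charlier_zeros (a r) (N k) (M k)" for k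
    define z where "z k = prepend_naturals (P k) (charlier_zeros (real (N k) * a r) (M k))" for k
    have x_range: "\<forall>\<^sub>F k in sequentially. \<forall>j<M k. x k j \<in> {0..K}"
      unfolding x_def by (rule in_range [OF N MN])

    \<comment> \<open>for large \<open>N\<close> the last parameter exceeds all others, so the parameters are pairwise distinct\<close>
    define separated where "separated k \<longleftrightarrow> 0 < N k \<and> (\<forall>j\<in>{1..<r}. a j < real (N k) * a r)" for k
    have ev_separated: "\<forall>\<^sub>F k in sequentially. separated k"
      unfolding separated_def
    proof (intro eventually_conj N_pos eventually_ball_finite ballI)
      fix j
      have "\<forall>\<^sub>F k in sequentially. a j / a r < real (N k)"
        using N' by (simp add: filterlim_at_top_dense)
      then show "\<forall>\<^sub>F k in sequentially. a j < real (N k) * a r"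
        by eventually_elim (use ar in \<open>simp add: divide_less_eq\<close>)
    qed simp
    have "\<exists>y. separated k \<longrightarrow> mesh_zeros (S k) y (multiple_charlier r (scaled_params r a (N k)) (L k)) \<and>
        (\<forall>i<S k. z k i \<le> y i) \<and> (\<Sum>i<S k. y i - z k i) = (\<Sum>j=1..<r. real (L k j) * a j)" for k
    proof (cases "separated k")
      case True
      let ?b = "scaled_params r a (N k)"
      have less: "a j < real (N k) * a r" if "j \<in> {1..<r}" for j
        using True that by (simp add: separated_def)
      have inj: "inj_on ?b {1..r}"
      proof (rule inj_onI)
        fix i j assume ij: "i \<in> {1..r}" "j \<in> {1..r}" and eq: "?b i = ?b j"
        show "i = j"
        proof (cases "i = r \<or> j = r")
          case True
          then show ?thesis
            using eq ij less [of i] less [of j] by (auto simp: scaled_params_def split: if_splits)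
        next
          case False
          then show ?thesis
            using eq ij inj_onD [OF assms(2), of i j] by (auto simp: scaled_params_def)
        qed
      qed
      have pos: "0 < ?b j" if "j \<in> {1..r}" for j
        using True assms(1) [OF that] ar by (auto simp: scaled_params_def separated_def)
      have br: "?b r = real (N k) * a r" by (simp add: scaled_params_def)
      have sum: "(\<Sum>j=1..<r. real (L k j) * ?b j) = (\<Sum>j=1..<r. real (L k j) * a j)"
        by (intro sum.cong) (auto simp: scaled_params_def)
      obtain y where "mesh_zeros (S k) y (multiple_charlier r ?b (L k))"
        "\<And>i. i < S k \<Longrightarrow> z k i \<le> y i"
        "(\<Sum>i<S k. y i - z k i) = (\<Sum>j=1..<r. real (L k j) * a j)"
        using multiple_charlier_zeros [OF r inj pos, of "L k"]
        unfolding br sum M_def [symmetric] P_def [symmetric] S_def [symmetric] z_def [symmetric]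
        by blast
      then show ?thesis by blast
    qed simp
    then obtain y where y: "\<And>k. separated k \<Longrightarrow>
        mesh_zeros (S k) (y k) (multiple_charlier r (scaled_params r a (N k)) (L k)) \<and>
        (\<forall>i<S k. z k i \<le> y k i) \<and> (\<Sum>i<S k. y k i - z k i) = (\<Sum>j=1..<r. real (L k j) * a j)"
      by metis

    \<comment> \<open>the zeros may be replaced by the comparison zeros, as their mean distance is of order \<open>1/N\<close>\<close>
    have perturb: "(\<lambda>k. average (S k) (\<lambda>i. z k i / real (N k)) f -
        average (S k) (\<lambda>i. y k i / real (N k)) f) \<longlonglongrightarrow> 0"
    proof (rule average_perturbation [OF f(1) B])
      show "\<forall>\<^sub>F k in sequentially. \<forall>j<S k. z k j / real (N k) \<in> {0..\<gamma> + 1 + K} \<and> 0 \<le> y k j / real (N k)"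
        using ev_separated N_pos x_range PN_less
      proof eventually_elim
        case (elim k)
        show ?case
        proof (intro allI impI conjI)
          fix j assume j: "j < S k"
          show "0 \<le> y k j / real (N k)"
            using y [OF elim(1)] mesh_zerosD(3) j by auto
          show "z k j / real (N k) \<in> {0..\<gamma> + 1 + K}"
          proof (cases "j < P k")
            case True
            then have "real j / real (N k) \<le> real (P k) / real (N k)"
              by (intro divide_right_mono) auto
            then have "real j / real (N k) \<le> \<gamma> + 1 + K" using elim(4) K by linarith
            then show ?thesis using True by (simp add: z_def prepend_naturals_def)
          next
            case False
            then have eq: "z k j / real (N k) = real (P k) / real (N k) + x k (j - P k)"
              by (simp add: z_def prepend_naturals_def x_def scaled_charlier_zeros_def add_divide_distrib)
            have "j - P k < M k" using False j by (simp add: S_def)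
            then have "x k (j - P k) \<in> {0..K}" using elim(3) by blast
            moreover have "0 \<le> real (P k) / real (N k)" by simp
            ultimately show ?thesis unfolding eq atLeastAtMost_iff using elim(4) by linarith
          qed
        qed
      qed
      have "(\<lambda>k. (\<Sum>j=1..<r. real (L k j) / real (S k) * a j) / real (N k)) \<longlonglongrightarrow> 0"
      proof (rule tendsto_divide_0 [OF _ filterlim_at_top_imp_at_infinity [OF N']])
        show "(\<lambda>k. \<Sum>j=1..<r. real (L k j) / real (S k) * a j) \<longlonglongrightarrow> (\<Sum>j=1..<r. q j * a j)"
          by (intro tendsto_intros over_S L_lim) auto
      qed
      then show "(\<lambda>k. (\<Sum>j<S k. \<bar>z k j / real (N k) - y k j / real (N k)\<bar>) / real (S k)) \<longlonglongrightarrow> 0"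
      proof (rule Lim_transform_eventually)
        show "\<forall>\<^sub>F k in sequentially. (\<Sum>j=1..<r. real (L k j) / real (S k) * a j) / real (N k) =
            (\<Sum>j<S k. \<bar>z k j / real (N k) - y k j / real (N k)\<bar>) / real (S k)"
          using ev_separated
        proof eventually_elim
          case (elim k)
          have "(\<Sum>j<S k. \<bar>z k j / real (N k) - y k j / real (N k)\<bar>) =
              (\<Sum>j<S k. (y k j - z k j) / real (N k))"
            using y [OF elim] by (intro sum.cong) (auto simp: diff_divide_distrib [symmetric] abs_divide)
          also have "\<dots> = (\<Sum>j=1..<r. real (L k j) * a j) / real (N k)"
            using y [OF elim] by (simp add: sum_divide_distrib [symmetric])
          finally show ?case by (simp add: sum_divide_distrib mult.commute)
        qed
      qed
    qed

    \<comment> \<open>the zeros that became \<open>0, \<dots>, P - 1\<close> form a Riemann sum of mesh \<open>1/N\<close>\<close>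
    have first: "(\<lambda>k. (\<Sum>i<P k. f (real i / real (N k))) / real (S k)) \<longlonglongrightarrow> integral {0..\<gamma>} f / t"
    proof (rule Lim_transform_eventually)
      show "(\<lambda>k. ((\<Sum>i<P k. f (real i / real (N k))) / real (N k)) / (real (S k) / real (N k))) \<longlonglongrightarrow>
          integral {0..\<gamma>} f / t"
        using \<gamma> t by (intro tendsto_divide riemann_sum_tendsto [OF f(1) N PN] SN) auto
      show "\<forall>\<^sub>F k in sequentially. ((\<Sum>i<P k. f (real i / real (N k))) / real (N k)) /
          (real (S k) / real (N k)) = (\<Sum>i<P k. f (real i / real (N k))) / real (S k)"
        using N_pos by eventually_elim simp
    qed

    \<comment> \<open>the shift \<open>P/N\<close> of the Charlier zeros may be replaced by its limit \<open>\<gamma>\<close>\<close>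
    have "(\<lambda>k. average (M k) (\<lambda>j. \<gamma> + x k j) f -
        average (M k) (\<lambda>j. real (P k) / real (N k) + x k j) f) \<longlonglongrightarrow> 0"
    proof (rule average_perturbation [OF f(1) B])
      show "\<forall>\<^sub>F k in sequentially. \<forall>j<M k. \<gamma> + x k j \<in> {0..\<gamma> + K} \<and> 0 \<le> real (P k) / real (N k) + x k j"
        using x_range by eventually_elim (use \<gamma> in auto)
      have "(\<lambda>k. \<bar>\<gamma> - real (P k) / real (N k)\<bar>) \<longlonglongrightarrow> \<bar>\<gamma> - \<gamma>\<bar>"
        by (intro tendsto_intros PN)
      then have "(\<lambda>k. \<bar>\<gamma> - real (P k) / real (N k)\<bar>) \<longlonglongrightarrow> 0" by simp
      then show "(\<lambda>k. (\<Sum>j<M k. \<bar>\<gamma> + x k j - (real (P k) / real (N k) + x k j)\<bar>) / real (M k)) \<longlonglongrightarrow> 0"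
        by (rule Lim_null_comparison [rotated]) (auto intro!: always_eventually)
    qed
    moreover have "continuous_on {0..K} (\<lambda>u. f (\<gamma> + u))"
      by (rule continuous_on_compose2 [OF f(1)]) (use \<gamma> in \<open>auto intro!: continuous_intros\<close>)
    from lim [OF N MN this]
    have "(\<lambda>k. average (M k) (\<lambda>j. \<gamma> + x k j) f) \<longlonglongrightarrow> (LBINT u:{0..K}. w u * f (\<gamma> + u))"
      by (simp add: average_def x_def)
    ultimately have second: "(\<lambda>k. average (M k) (\<lambda>j. real (P k) / real (N k) + x k j) f) \<longlonglongrightarrow>
        (LBINT u:{0..K}. w u * f (\<gamma> + u))"
      using tendsto_diff by fastforce

    have z_avg: "average (S k) (\<lambda>i. z k i / real (N k)) f =
        (\<Sum>i<P k. f (real i / real (N k))) / real (S k) +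
        real (M k) / real (S k) * average (M k) (\<lambda>j. real (P k) / real (N k) + x k j) f" for k
      unfolding S_def z_def average_prepend x_def scaled_charlier_zeros_def ..
    have "(\<lambda>k. average (S k) (\<lambda>i. z k i / real (N k)) f) \<longlonglongrightarrow>
        integral {0..\<gamma>} f / t + q r * (LBINT u:{0..K}. w u * f (\<gamma> + u))"
      unfolding z_avg by (intro tendsto_add tendsto_mult first second over_S M_lim)
    from tendsto_diff [OF this perturb]
    have "(\<lambda>k. average (S k) (\<lambda>i. y k i / real (N k)) f) \<longlonglongrightarrow>
        integral {0..\<gamma>} f / t + q r * (LBINT u:{0..K}. w u * f (\<gamma> + u))"
      by simp
    moreover have "\<forall>\<^sub>F k in sequentially. average (S k) (\<lambda>i. y k i / real (N k)) f =
        zero_average r a q (n k) (N k) f"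
      using ev_separated
    proof eventually_elim
      case (elim k)
      then show ?case
        using y [OF elim] zero_average_eq [of r q "n k" "y k" a "N k" f] size [of k]
        by (simp add: L_def)
    qed
    ultimately have "(\<lambda>k. zero_average r a q (n k) (N k) f) \<longlonglongrightarrow>
        integral {0..\<gamma>} f / t + q r * (LBINT u:{0..K}. w u * f (\<gamma> + u))"
      by (rule Lim_transform_eventually)
    moreover have "set_integrable lborel {0..\<gamma>} f"
      by (rule borel_integrable_atLeastAtMost') (rule continuous_on_subset [OF f(1)], simp)
    then have "(LBINT x:{0..\<gamma>}. f x) = integral {0..\<gamma>} f"
      by (rule set_borel_integral_eq_integral)
    ultimately show ?thesis by (simp add: prob_density_on_shift(2) [OF w])
  qed
  then show "\<exists>\<alpha> \<beta> v. \<alpha> < \<beta> \<and> (1 - q r) * t \<le> \<alpha> \<and> prob_density_on \<alpha> \<beta> v \<and>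
    (\<forall>f :: real \<Rightarrow> real. continuous_on {0..} f \<and> bounded (f ` {0..}) \<longrightarrow>
      (\<forall>n N :: nat \<Rightarrow> nat.
         filterlim n at_top sequentially \<and> filterlim N at_top sequentially \<and>
         (\<lambda>k. real (n k) / real (N k)) \<longlonglongrightarrow> t \<longrightarrow>
         (\<lambda>k. zero_average r a q (n k) (N k) f) \<longlonglongrightarrow>
           1 / t * (LBINT x:{0..(1 - q r) * t}. f x) + q r * (LBINT x:{\<alpha>..\<beta>}. v x * f x)))"
    using K prob_density_on_shift(1) [OF w, of \<gamma>]
    unfolding \<gamma>_def [symmetric]
    by (intro exI [of _ \<gamma>] exI [of _ "\<gamma> + K"] exI [of _ "\<lambda>x. w (x - \<gamma>)"] conjI allI impI) auto
qed

end
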